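(* Let $n\ge 2$, and let $G$ be a weighted graph on the vertex set $V=\{1,\dots,n\}$ with edge weights $c_{xy}\ge 0$ whose skeleton graph is connected. Then the interchange process on $G$ and the random walk on $G$ have the same spectral gap: $$\lambda_1^{IP}(G)=\lambda_1^{RW}(G).$$
   Context: A weighted graph $G=(V,E)$ is the undirected complete graph on $V=\{1,\dots,n\}$ (so $E$ is the set of all unordered pairs $xy=\{x,y\}$, $x\ne y$) together with real weights $c_{xy}=c_{yx}\ge 0$, $xy\in E$. Standing assumption: the skeleton graph, i.e. the graph on $V$ with edge set $\{xy\in E: c_{xy}>0\}$, is connected. Random walk: the operator $\mathcal L^{RW}$ on functions $f:V\to\mathbb R$ given by $\mathcal L^{RW}f(x)=\sum_{y\ne x}c_{xy}(f(y)-f(x))$. Interchange process: let $\mathcal X_n$ be the set of permutations of $V$; an element $\eta\in\mathcal X_n$ is viewed as an assignment of the particle labels $1,\dots,n$ to the vertices, where $\eta_x$ is the label of the particle at vertex $x$. For $xy\in E$, $\eta^{xy}$ is obtained from $\eta$ by interchanging the particles at $x$ and $y$ (composition of $\eta$ with the transposition $\tau_{xy}$). The operator $\mathcal L^{IP}$ on functions $f:\mathcal X_n\to\mathbb R$ is $\mathcal L^{IP}f(\eta)=\sum_{xy\in E}c_{xy}(f(\eta^{xy})-f(\eta))$. Each of $-\mathcal L^{RW}$, $-\mathcal L^{IP}$ is a symmetric positive semidefinite operator (with respect to the standard inner product on functions on the finite state space), with eigenvalues listed with multiplicity $0=\lambda_0<\lambda_1\le\lambda_2\le\cdots$; the spectral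 gap is $\lambda_1$, denoted $\lambda_1^{RW}(G)$ and $\lambda_1^{IP}(G)$ respectively. Equivalently, $\lambda_1$ is the largest $\lambda$ such that $-\sum_i g(i)\,\mathcal L g(i)\ge\lambda\sum_i g(i)^2$ for all real functions $g$ on the state space with $\sum_i g(i)=0$. *)

theory Defs
  imports Complex_Main "HOL-Combinatorics.Transposition" "HOL-Combinatorics.Permutations"
    "HOL-Library.Function_Algebras"
begin

text \<open>
  Functions \<open>f : S \<rightarrow> \<real>\<close> on a finite state space \<open>S\<close> are represented by functions on the ambient
  type that vanish outside \<open>S\<close>; they form a real vector space of dimension \<open>card S\<close> under the
  pointwise operations.
\<close>

abbreviation fun_scale :: "real \<Rightarrow> ('a \<Rightarrow> real) \<Rightarrow> 'a \<Rightarrow> real" where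
  "fun_scale a f \<equiv> (\<lambda>x. a * f x)"

lemma vector_space_fun_scale: "vector_space (fun_scale :: real \<Rightarrow> ('a \<Rightarrow> real) \<Rightarrow> 'a \<Rightarrow> real)"
  by unfold_locales (auto simp: fun_eq_iff algebra_simps)

definition eigenspace ::
    "'a set \<Rightarrow> (('a \<Rightarrow> real) \<Rightarrow> 'a \<Rightarrow> real) \<Rightarrow> real \<Rightarrow> ('a \<Rightarrow> real) set" where
  "eigenspace S A l = {f. (\<forall>x. x \<notin> S \<longrightarrow> f x = 0) \<and> (\<forall>x\<in>S. A f x = l * f x)}"

definition eig_multiplicity :: "'a set \<Rightarrow> (('a \<Rightarrow> real) \<Rightarrow> 'a \<Rightarrow> real) \<Rightarrow> real \<Rightarrow> nat" where
  "eig_multiplicity S A l = vector_space.dim fun_scale (eigenspace S A l)"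

text \<open>
  The eigenvalues in increasing order, each repeated according to the dimension of its eigenspace.
  For the symmetric operators considered here this is also the algebraic multiplicity, so the list
  has length \<open>card S\<close>.
\<close>

definition eigenvalue_list :: "'a set \<Rightarrow> (('a \<Rightarrow> real) \<Rightarrow> 'a \<Rightarrow> real) \<Rightarrow> real list" where
  "eigenvalue_list S A = (THE ls. sorted ls \<and> (\<forall>l. count_list ls l = eig_multiplicity S A l))"

text \<open>The spectral gap \<open>\<lambda>\<^sub>1\<close> of a generator \<open>L\<close>: the list \<open>\<lambda>\<^sub>0 \<le> \<lambda>\<^sub>1 \<le> \<dots>\<close> is that of \<open>- L\<close>.\<close>

definition spectral_gap :: "'a set \<Rightarrow> (('a \<Rightarrow> real) \<Rightarrow> 'a \<Rightarrow> real) \<Rightarrow> real" where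
  "spectral_gap S L = eigenvalue_list S (\<lambda>f x. - L f x) ! 1"

text \<open>Only the values \<open>c x y\<close> with \<open>x \<noteq> y\<close> in \<open>{1..n}\<close> are meaningful.\<close>

definition weighted_graph :: "nat \<Rightarrow> (nat \<Rightarrow> nat \<Rightarrow> real) \<Rightarrow> bool" where
  "weighted_graph n c \<longleftrightarrow>
     (\<forall>x\<in>{1..n}. \<forall>y\<in>{1..n}. x \<noteq> y \<longrightarrow> c x y = c y x \<and> c x y \<ge> 0)"

definition skeleton :: "nat \<Rightarrow> (nat \<Rightarrow> nat \<Rightarrow> real) \<Rightarrow> (nat \<times> nat) set" where
  "skeleton n c = {(x, y). x \<in> {1..n} \<and> y \<in> {1..n} \<and> x \<noteq> y \<and> c x y > 0}"

definition skeleton_connected :: "nat \<Rightarrow> (nat \<Rightarrow> nat \<Rightarrow> real) \<Rightarrow> bool" where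
  "skeleton_connected n c \<longleftrightarrow> (\<forall>x\<in>{1..n}. \<forall>y\<in>{1..n}. (x, y) \<in> (skeleton n c)\<^sup>*)"

definition L_RW :: "nat \<Rightarrow> (nat \<Rightarrow> nat \<Rightarrow> real) \<Rightarrow> (nat \<Rightarrow> real) \<Rightarrow> nat \<Rightarrow> real" where
  "L_RW n c f x = (\<Sum>y\<in>{1..n} - {x}. c x y * (f y - f x))"

definition configurations :: "nat \<Rightarrow> (nat \<Rightarrow> nat) set" where
  "configurations n = {\<eta>. \<eta> permutes {1..n}}"

text \<open>
  Each unordered pair \<open>xy\<close> is summed once, as \<open>x < y\<close>. Since \<open>\<eta> x\<close> is the label of the particle
  at \<open>x\<close>, interchanging the particles at \<open>x\<close> and \<open>y\<close> composes with the transposition on the right.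
\<close>

definition L_IP ::
    "nat \<Rightarrow> (nat \<Rightarrow> nat \<Rightarrow> real) \<Rightarrow> ((nat \<Rightarrow> nat) \<Rightarrow> real) \<Rightarrow> (nat \<Rightarrow> nat) \<Rightarrow> real" where
  "L_IP n c f \<eta> = (\<Sum>(x, y) \<in> {(x, y). x \<in> {1..n} \<and> y \<in> {1..n} \<and> x < y}.
      c x y * (f (\<eta> \<circ> transpose x y) - f \<eta>))"

definition gap_RW :: "nat \<Rightarrow> (nat \<Rightarrow> nat \<Rightarrow> real) \<Rightarrow> real" where
  "gap_RW n c = spectral_gap {1..n} (L_RW n c)"

definition gap_IP :: "nat \<Rightarrow> (nat \<Rightarrow> nat \<Rightarrow> real) \<Rightarrow> real" where
  "gap_IP n c = spectral_gap (configurations n) (L_IP n c)"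

end

theory Submission
  imports Defs "HOL-Library.Multiset" "HOL-Analysis.Function_Topology"
begin

text \<open>
  This is Aldous' spectral gap conjecture; the proof follows the strategy of Caputo, Liggett and
  Richthammer.

  Both processes are generators \<open>L f x = (\<Sum>y\<in>S. k x y * (f y - f x))\<close> of a symmetric kernel on
  a finite set. The gap is the unique \<open>m > 0\<close> which is an eigenvalue of \<open>- L\<close> and for
  which \<open>m * \<parallel>f\<parallel>\<^sup>2 \<le> E f\<close> holds for all \<open>f\<close> of mean zero, where \<open>E\<close> is the Dirichlet form
  (\<open>spectral_gap_eqI\<close>). Minimising the Rayleigh quotient yields such an \<open>m\<close>
  (\<open>ex_poincare_eigenfunction\<close>); for the walk it is positive because the skeleton is connected
  (\<open>connected_eigenvalue_pos\<close>).

  The position of a single particle performs the random walk, so each eigenfunction of the walk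
  lifts to one of the interchange process with the same eigenvalue (\<open>L_IP_lift\<close>). It remains to see
  that an inequality \<open>l * \<parallel>g\<parallel>\<^sup>2 \<le> E g\<close> for the walk, with \<open>l \<ge> 0\<close>, passes to the interchange process
  (\<open>poincare_exchange\<close>). This is by induction on the number of vertices. Let \<open>f\<close> be an extremal
  eigenfunction, of eigenvalue \<open>m\<close>, of the interchange process on \<open>Suc n\<close> vertices. Summing \<open>f\<close> over
  all configurations that have particle \<open>i\<close> at \<open>x\<close> gives a function of \<open>x\<close> satisfying the eigenvalue
  equation of the walk (\<open>L_RW_marginal\<close>). If one of these
  marginals does not vanish at the last vertex then \<open>l \<le> m\<close>. Otherwise
  \<open>f\<close> has mean zero on each set of configurations with a prescribed particle at the last vertex. Such
  a set is a copy of the configuration space of the remaining \<open>n\<close> vertices, and the induction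
  hypothesis is applied there, with the weights of the electrically reduced network: the removed vertex,
  with conductances \<open>a y\<close>, is replaced by additional conductances \<open>a y * a z / sum a\<close>.

  Two facts make this work. The inequality for the walk survives the reduction, since a function on
  the smaller network has the same energy as its harmonic extension (\<open>poincare_reduced\<close>). And the
  reduction does not increase the energy of the interchange process; this is the octopus inequality
  (\<open>octopus_inequality\<close>), the heart of the proof.

  Let \<open>x\<close> be the removed vertex and let \<open>\<tau>\<^sub>i\<^sub>j\<close> act on functions of permutations by composing with the
  transposition of \<open>i\<close> and \<open>j\<close>. The octopus inequality says that the operator
  \<open>P = \<Sum> a\<^sub>i a\<^sub>j p\<^sub>i\<^sub>j\<close>, with \<open>p\<^sub>i\<^sub>j = 1 + \<tau>\<^sub>i\<^sub>j - \<tau>\<^sub>x\<^sub>i - \<tau>\<^sub>x\<^sub>j\<close>, is positive semidefinite for all \<open>a \<ge> 0\<close>. The identity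
  has coefficient \<open>s = \<Sum> a\<^sub>i a\<^sub>j (1 + \<delta>\<^sub>i\<^sub>j)\<close> in \<open>P\<close>, and \<open>P - s\<close> is a combination of transpositions, so it
  is natural to prove \<open>(P - s)\<^sup>2 \<le> s\<^sup>2\<close>, that is \<open>P\<^sup>2 \<le> 2 s P\<close>. The difference \<open>2 s P - P\<^sup>2\<close> is a quartic form in
  \<open>a\<close>. Symmetrising the coefficient of \<open>a\<^sub>i a\<^sub>j a\<^sub>k a\<^sub>l\<close> leaves an element \<open>W\<close> of the group algebra of the
  symmetric group on at most five points, and \<open>W\<close> turns out to be a nonnegative multiple of a
  projection: \<open>W\<^sup>2 = 24 W\<close> (\<open>sym_quad_op_square\<close>). Hence each coefficient is positive semidefinite.
\<close>

section \<open>The spectral gap of a symmetric kernel\<close>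

definition generator :: "'a set \<Rightarrow> ('a \<Rightarrow> 'a \<Rightarrow> real) \<Rightarrow> ('a \<Rightarrow> real) \<Rightarrow> 'a \<Rightarrow> real" where
  "generator S k f x = (\<Sum>y\<in>S. k x y * (f y - f x))"

definition dirichlet ::
    "'a set \<Rightarrow> ('a \<Rightarrow> 'a \<Rightarrow> real) \<Rightarrow> ('a \<Rightarrow> real) \<Rightarrow> ('a \<Rightarrow> real) \<Rightarrow> real" where
  "dirichlet S k f g = (\<Sum>x\<in>S. \<Sum>y\<in>S. k x y * ((f y - f x) * (g y - g x))) / 2"

definition poincare :: "'a set \<Rightarrow> ('a \<Rightarrow> 'a \<Rightarrow> real) \<Rightarrow> real \<Rightarrow> bool" where
  "poincare S k m \<longleftrightarrow> (\<forall>f. sum f S = 0 \<longrightarrow> m * (\<Sum>x\<in>S. (f x)\<^sup>2) \<le> dirichlet S k f f)"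

definition symmetric_on :: "'a set \<Rightarrow> ('a \<Rightarrow> 'a \<Rightarrow> real) \<Rightarrow> bool" where
  "symmetric_on S k \<longleftrightarrow> (\<forall>x\<in>S. \<forall>y\<in>S. k x y = k y x)"

lemma dirichlet_green:
  assumes "symmetric_on S k"
  shows "dirichlet S k f g = - (\<Sum>x\<in>S. g x * generator S k f x)"
proof -
  have "(\<Sum>x\<in>S. \<Sum>y\<in>S. k x y * ((f y - f x) * g y)) = (\<Sum>x\<in>S. \<Sum>y\<in>S. k x y * ((f x - f y) * g x))"
    using assms by (subst sum.swap) (auto simp: symmetric_on_def intro!: sum.cong)
  then have "2 * dirichlet S k f g = (\<Sum>x\<in>S. \<Sum>y\<in>S. k x y * ((f x - f y) * g x))
      - (\<Sum>x\<in>S. \<Sum>y\<in>S. k x y * ((f y - f x) * g x))"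
    by (simp add: dirichlet_def right_diff_distrib sum_subtractf)
  also have "\<dots> = (\<Sum>x\<in>S. \<Sum>y\<in>S. - 2 * (g x * (k x y * (f y - f x))))"
    by (simp only: sum_subtractf[symmetric]) (simp add: algebra_simps)
  also have "\<dots> = - 2 * (\<Sum>x\<in>S. g x * generator S k f x)"
    by (simp only: generator_def sum_distrib_left)
  finally show ?thesis by simp
qed

lemma dirichlet_add_scaled:
  "dirichlet S k (\<lambda>x. f x + t * h x) (\<lambda>x. f x + t * h x) =
     dirichlet S k f f + 2 * t * dirichlet S k f h + t\<^sup>2 * dirichlet S k h h"
proof -
  have "k x y * ((f y + t * h y - (f x + t * h x)) * (f y + t * h y - (f x + t * h x))) =
      k x y * ((f y - f x) * (f y - f x)) + 2 * t * (k x y * ((f y - f x) * (h y - h x)))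
      + t\<^sup>2 * (k x y * ((h y - h x) * (h y - h x)))" for x y
    by (simp add: power2_eq_square algebra_simps)
  then show ?thesis
    unfolding dirichlet_def by (simp add: sum.distrib sum_distrib_left add_divide_distrib)
qed

lemma dirichlet_scale:
  "dirichlet S k (\<lambda>x. t * h x) (\<lambda>x. t * h x) = t\<^sup>2 * dirichlet S k h h"
  using dirichlet_add_scaled[of S k "\<lambda>_. 0" t h] by (simp add: dirichlet_def)

lemma dirichlet_cong:
  assumes "\<And>x. x \<in> S \<Longrightarrow> f x = f' x"
  shows "dirichlet S k f f = dirichlet S k f' f'"
  using assms by (simp add: dirichlet_def)

lemma generator_sum_zero:
  assumes "symmetric_on S k"
  shows "(\<Sum>x\<in>S. generator S k f x) = 0"
  using dirichlet_green[OF assms, of f "\<lambda>_. 1"] by (simp add: dirichlet_def)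

text \<open>
  A quadratic polynomial in \<open>t\<close> that is nonnegative and vanishes at \<open>0\<close> has derivative zero there;
  this is the first-order condition at the minimum of the Rayleigh quotient.
\<close>

lemma linear_term_zero:
  fixes b c :: real
  assumes "\<And>t. 0 \<le> 2 * t * b + t\<^sup>2 * c" "0 \<le> c"
  shows "b = 0"
proof (rule ccontr)
  assume "b \<noteq> 0"
  \<comment> \<open>close to the minimiser \<open>- b / c\<close>, but defined also for \<open>c = 0\<close>\<close>
  define t where "t = - b / (1 + c)"
  have t: "t * (1 + c) = - b" using assms(2) by (simp add: t_def)
  have "t \<noteq> 0" using \<open>b \<noteq> 0\<close> assms(2) by (simp add: t_def)
  have "2 * t * b + t\<^sup>2 * c = - (t\<^sup>2 * (2 + c))"
  proof -
    have b: "b = - (t * (1 + c))" using t by simp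
    show ?thesis unfolding b by (simp add: power2_eq_square algebra_simps)
  qed
  also have "\<dots> < 0" using \<open>t \<noteq> 0\<close> assms(2) by (simp add: zero_less_mult_iff)
  finally show False using assms(1)[of t] by simp
qed

text \<open>
  The functions supported on \<open>S\<close> with values in \<open>{-1..1}\<close> form a compact box in the product topology, and
  the set in question is a closed subset of it.
\<close>

lemma compact_unit_functions:
  assumes fin: "finite S"
  shows "compact {f :: 'a \<Rightarrow> real. (\<forall>x. x \<notin> S \<longrightarrow> f x = 0) \<and> sum f S = 0 \<and> (\<Sum>x\<in>S. (f x)\<^sup>2) = 1}"
    (is "compact ?K")
proof -
  let ?P = "PiE UNIV (\<lambda>x. if x \<in> S then {-1..1::real} else {0})"
  have "compactin (product_topology (\<lambda>i. euclidean) UNIV) ?P"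
    unfolding compactin_PiE by (auto simp: compactin_euclidean_iff)
  then have P: "compact ?P"
    by (simp add: euclidean_product_topology compactin_euclidean_iff)
  have C: "closed {f :: 'a \<Rightarrow> real. sum f S = 0 \<and> (\<Sum>x\<in>S. (f x)\<^sup>2) = 1}"
    by (intro closed_Collect_conj closed_Collect_eq continuous_intros
        continuous_on_product_coordinates)
  have "?K = ?P \<inter> {f. sum f S = 0 \<and> (\<Sum>x\<in>S. (f x)\<^sup>2) = 1}"
  proof (intro equalityI subsetI)
    fix f assume f: "f \<in> ?K"
    have "\<bar>f x\<bar> \<le> 1" if "x \<in> S" for x
    proof -
      have "(f x)\<^sup>2 \<le> (\<Sum>x\<in>S. (f x)\<^sup>2)"
        using fin that by (intro member_le_sum) auto
      with f have "(f x)\<^sup>2 \<le> 1" by simp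
      then show ?thesis by (simp add: abs_square_le_1)
    qed
    with f show "f \<in> ?P \<inter> {f. sum f S = 0 \<and> (\<Sum>x\<in>S. (f x)\<^sup>2) = 1}"
      by (auto simp: abs_le_iff PiE_iff minus_le_iff)
  qed (auto simp: PiE_iff split: if_splits)
  with compact_Int_closed[OF P C] show ?thesis by simp
qed

text \<open>
  The Dirichlet form attains its minimum \<open>m\<close> on the unit sphere of the functions of mean zero, and
  scaling gives the Poincare inequality. At a minimiser \<open>f\<close> the variation in the direction
  \<open>h = L f + m f\<close>, which again has mean zero, is \<open>- \<parallel>h\<parallel>\<^sup>2\<close>; hence \<open>h = 0\<close>.
\<close>

lemma ex_poincare_eigenfunction:
  assumes fin: "finite S" and two: "2 \<le> card S" and sym: "symmetric_on S k"
  shows "\<exists>m f. poincare S k m \<and> (\<exists>x\<in>S. f x \<noteq> 0) \<and> sum f S = 0 \<and>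
    (\<forall>x\<in>S. generator S k f x = - m * f x)"
proof -
  let ?K = "{f :: 'a \<Rightarrow> real. (\<forall>x. x \<notin> S \<longrightarrow> f x = 0) \<and> sum f S = 0 \<and> (\<Sum>x\<in>S. (f x)\<^sup>2) = 1}"
  \<comment> \<open>the sphere is not empty: a normalised difference of two point masses\<close>
  obtain a b where ab: "a \<in> S" "b \<in> S" "a \<noteq> b"
    using two card_le_Suc0_iff_eq[OF fin] by fastforce
  define g :: "'a \<Rightarrow> real" where "g x = (of_bool (x = a) - of_bool (x = b)) / sqrt 2" for x
  have "(\<Sum>x\<in>S. (g x)\<^sup>2) = (\<Sum>x\<in>S. of_bool (x = a) / 2 + of_bool (x = b) / 2)"
    using ab by (intro sum.cong) (auto simp: g_def power_divide)
  also have "\<dots> = 1"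
    using ab fin by (simp add: sum.distrib sum_divide_distrib[symmetric] of_bool_def)
  finally have "g \<in> ?K"
    using ab fin
    by (auto simp: g_def sum_divide_distrib[symmetric] sum_subtractf of_bool_def)
  then have ne: "?K \<noteq> {}" by blast
  have cont: "continuous_on ?K (\<lambda>f. dirichlet S k f f)"
    unfolding dirichlet_def
    by (intro continuous_intros continuous_on_subset[OF continuous_on_product_coordinates]) auto
  obtain f where f: "f \<in> ?K" and min: "\<And>g. g \<in> ?K \<Longrightarrow> dirichlet S k f f \<le> dirichlet S k g g"
    using continuous_attains_inf[OF compact_unit_functions[OF fin] ne cont] by blast
  define m where "m = dirichlet S k f f"
  have poin: "poincare S k m"
    unfolding poincare_def
  proof (intro allI impI)
    fix h :: "'a \<Rightarrow> real" assume h: "sum h S = 0"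
    define N where "N = (\<Sum>x\<in>S. (h x)\<^sup>2)"
    show "m * (\<Sum>x\<in>S. (h x)\<^sup>2) \<le> dirichlet S k h h"
    proof (cases "N = 0")
      case True
      then have "h x = 0" if "x \<in> S" for x
        using that fin by (simp add: N_def sum_nonneg_eq_0_iff)
      then have "dirichlet S k h h = 0" by (simp add: dirichlet_def)
      with True show ?thesis by (simp add: N_def)
    next
      case False
      then have N: "N > 0" by (simp add: N_def order_less_le sum_nonneg)
      define h' where "h' x = (if x \<in> S then (1 / sqrt N) * h x else 0)" for x
      have "(\<Sum>x\<in>S. (h' x)\<^sup>2) = (\<Sum>x\<in>S. (h x)\<^sup>2 / N)"
        using N by (intro sum.cong) (auto simp: h'_def power_divide)
      also have "\<dots> = 1" using N by (simp add: sum_divide_distrib[symmetric] N_def)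
      finally have "h' \<in> ?K"
        using h by (auto simp: h'_def sum_divide_distrib[symmetric])
      then have "m \<le> dirichlet S k h' h'"
        using min by (simp add: m_def)
      also have "dirichlet S k h' h' = dirichlet S k (\<lambda>x. (1 / sqrt N) * h x) (\<lambda>x. (1 / sqrt N) * h x)"
        by (rule dirichlet_cong) (simp add: h'_def)
      also have "\<dots> = dirichlet S k h h / N"
        using N unfolding dirichlet_scale by (simp add: power_divide)
      finally show ?thesis using N by (simp add: N_def pos_le_divide_eq)
    qed
  qed
  have "\<forall>x\<in>S. generator S k f x = - m * f x"
  proof -
    define h where "h x = generator S k f x + m * f x" for x
    have h0: "sum h S = 0"
      using f generator_sum_zero[OF sym, of f]
      by (simp add: h_def sum.distrib sum_distrib_left[symmetric])
    define b where "b = dirichlet S k f h - m * (\<Sum>x\<in>S. f x * h x)"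
    have "b = 0"
    proof (rule linear_term_zero)
      let ?c = "dirichlet S k h h - m * (\<Sum>x\<in>S. (h x)\<^sup>2)"
      show "0 \<le> ?c" using poin h0 by (simp add: poincare_def)
      fix t
      have z: "(\<Sum>x\<in>S. f x + t * h x) = 0"
        using f h0 by (simp add: sum.distrib sum_distrib_left[symmetric])
      have "(\<Sum>x\<in>S. (f x + t * h x)\<^sup>2) =
          (\<Sum>x\<in>S. (f x)\<^sup>2 + 2 * t * (f x * h x) + t\<^sup>2 * (h x)\<^sup>2)"
        by (intro sum.cong) (auto simp: power2_eq_square algebra_simps)
      also have "\<dots> = 1 + 2 * t * (\<Sum>x\<in>S. f x * h x) + t\<^sup>2 * (\<Sum>x\<in>S. (h x)\<^sup>2)"
        using f by (simp add: sum.distrib sum_distrib_left)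
      finally have sq: "(\<Sum>x\<in>S. (f x + t * h x)\<^sup>2) =
          1 + 2 * t * (\<Sum>x\<in>S. f x * h x) + t\<^sup>2 * (\<Sum>x\<in>S. (h x)\<^sup>2)" .
      have "m * (\<Sum>x\<in>S. (f x + t * h x)\<^sup>2) \<le>
          m + 2 * t * dirichlet S k f h + t\<^sup>2 * dirichlet S k h h"
        using poin[unfolded poincare_def, rule_format, OF z]
        by (simp only: dirichlet_add_scaled m_def)
      then show "0 \<le> 2 * t * b + t\<^sup>2 * ?c"
        unfolding sq b_def by (simp add: algebra_simps)
    qed
    moreover have "b = - (\<Sum>x\<in>S. (h x)\<^sup>2)"
      unfolding b_def dirichlet_green[OF sym]
      by (simp add: sum_distrib_left sum_negf[symmetric] sum_subtractf[symmetric]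
          h_def power2_eq_square algebra_simps)
    ultimately have "(\<Sum>x\<in>S. (h x)\<^sup>2) = 0" by simp
    then have "\<forall>x\<in>S. h x = 0"
      using fin by (simp add: sum_nonneg_eq_0_iff)
    then show ?thesis by (simp add: h_def add_eq_0_iff)
  qed
  moreover have "\<exists>x\<in>S. f x \<noteq> 0"
  proof (rule ccontr)
    assume "\<not> ?thesis"
    then have "(\<Sum>x\<in>S. (f x)\<^sup>2) = 0" by (intro sum.neutral) auto
    with f show False by simp
  qed
  ultimately show ?thesis using poin f by blast
qed

lemma sum_fun_apply: "(\<Sum>i\<in>I. F i) x = (\<Sum>i\<in>I. F i x)" for F :: "'i \<Rightarrow> 'a \<Rightarrow> real"
  by (induction I rule: infinite_finite_induct) auto

context
begin

interpretation fs: vector_space "fun_scale :: real \<Rightarrow> ('a \<Rightarrow> real) \<Rightarrow> 'a \<Rightarrow> real"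
  by (rule vector_space_fun_scale)

text \<open>
  The functions supported on \<open>S\<close> lie in the span of the \<open>card S\<close> point masses.
\<close>

lemma finite_independent_supported:
  assumes fin: "finite S" and indep: "fs.independent B"
    and supp: "\<And>f x. f \<in> B \<Longrightarrow> x \<notin> S \<Longrightarrow> f x = 0"
  shows "finite B"
proof -
  let ?D = "(\<lambda>a x. of_bool (x = a) :: real) ` S"
  have "f \<in> fs.span ?D" if "f \<in> B" for f
  proof -
    have "f = (\<Sum>a\<in>S. fun_scale (f a) (\<lambda>x. of_bool (x = a)))"
      using supp[OF that] fin by (auto simp: fun_eq_iff sum_fun_apply of_bool_def if_distrib cong: if_cong)
    also have "\<dots> \<in> fs.span ?D"
      by (intro fs.span_sum fs.span_scale fs.span_base) auto
    finally show ?thesis .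
  qed
  then show ?thesis
    using fs.independent_span_bound[OF _ indep, of ?D] fin by blast
qed

lemma independent_orthogonal:
  assumes orth: "\<And>f g. f \<in> B \<Longrightarrow> g \<in> B \<Longrightarrow> f \<noteq> g \<Longrightarrow> (\<Sum>x\<in>S. f x * g x) = 0"
    and nz: "\<And>f. f \<in> B \<Longrightarrow> (\<Sum>x\<in>S. f x * f x) \<noteq> 0"
  shows "fs.independent B"
  unfolding fs.independent_explicit_finite_subsets
proof (intro allI impI ballI)
  fix T u g assume T: "T \<subseteq> B" "finite T" and z: "(\<Sum>v\<in>T. fun_scale (u v) v) = 0" and g: "g \<in> T"
  have "(\<Sum>v\<in>T. u v * v x) = 0" for x
    using fun_cong[OF z, of x] by (simp add: sum_fun_apply)
  then have "0 = (\<Sum>x\<in>S. (\<Sum>v\<in>T. u v * v x) * g x)" by simp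
  also have "\<dots> = (\<Sum>v\<in>T. u v * (\<Sum>x\<in>S. v x * g x))"
    by (simp add: sum_distrib_left sum_distrib_right sum.swap[of _ T] mult.assoc)
  also have "\<dots> = (\<Sum>v\<in>T. if v = g then u g * (\<Sum>x\<in>S. g x * g x) else 0)"
    using T g orth by (intro sum.cong) (auto simp: subset_iff)
  also have "\<dots> = u g * (\<Sum>x\<in>S. g x * g x)" using T g by simp
  finally show "u g = 0" using nz[of g] T g by auto
qed

text \<open>
  Since \<open>dim\<close> is \<open>0\<close> for spaces of infinite dimension, the direction from right to left rests on the
  finiteness of \<open>S\<close>.
\<close>

lemma eig_multiplicity_pos_iff:
  assumes fin: "finite S"
  shows "0 < eig_multiplicity S A l \<longleftrightarrow> (\<exists>f\<in>eigenspace S A l. f \<noteq> 0)"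
proof
  assume "\<exists>f\<in>eigenspace S A l. f \<noteq> 0"
  then obtain f where f: "f \<in> eigenspace S A l" "f \<noteq> 0" by blast
  obtain B where B: "B \<subseteq> eigenspace S A l" "fs.independent B" "eigenspace S A l \<subseteq> fs.span B"
    "card B = fs.dim (eigenspace S A l)"
    by (rule fs.basis_exists)
  have "finite B"
    using B by (intro finite_independent_supported[OF fin B(2)]) (auto simp: eigenspace_def)
  moreover have "B \<noteq> {}" using B(3) f by auto
  ultimately show "0 < eig_multiplicity S A l"
    by (simp add: eig_multiplicity_def B(4)[symmetric] card_gt_0_iff)
next
  assume pos: "0 < eig_multiplicity S A l"
  show "\<exists>f\<in>eigenspace S A l. f \<noteq> 0"
  proof (rule ccontr)
    assume "\<not> ?thesis"
    then have "eigenspace S A l \<subseteq> fs.span {}" by auto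
    then have "fs.dim (eigenspace S A l) \<le> card ({} :: ('a \<Rightarrow> real) set)"
      by (rule fs.dim_le_card) simp
    with pos show False by (simp add: eig_multiplicity_def)
  qed
qed

lemma eig_multiplicity_zero_constants:
  assumes "S \<noteq> {}" and const: "eigenspace S A l = range (\<lambda>a x. a * of_bool (x \<in> S))"
  shows "eig_multiplicity S A l = 1"
  unfolding eig_multiplicity_def
proof (rule fs.dim_unique)
  let ?u = "\<lambda>x. of_bool (x \<in> S) :: real"
  have "?u = (\<lambda>a x. a * of_bool (x \<in> S)) 1" by simp
  then show "{?u} \<subseteq> eigenspace S A l"
    unfolding const by blast
  show "eigenspace S A l \<subseteq> fs.span {?u}"
    unfolding const using fs.span_scale[OF fs.span_base[of ?u "{?u}"]] by blast
  show "fs.independent {?u}"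
    using assms(1) by (auto simp: fs.dependent_single fun_eq_iff)
qed simp

end

lemma eigenvalue_list_eqI:
  assumes "sorted ls" "\<And>l. count_list ls l = eig_multiplicity S A l"
  shows "eigenvalue_list S A = ls"
  unfolding eigenvalue_list_def
proof (rule the_equality)
  show "sorted ls \<and> (\<forall>l. count_list ls l = eig_multiplicity S A l)"
    using assms by simp
  fix ls' assume ls': "sorted ls' \<and> (\<forall>l. count_list ls' l = eig_multiplicity S A l)"
  have "mset ls' = mset ls"
    using ls' assms by (intro multiset_eqI) (simp add: count_mset)
  with ls' assms(1) show "ls' = ls"
    by (metis properties_for_sort sorted_sort_id)
qed

text \<open>
  The Poincare inequality with \<open>m > 0\<close> forces the kernel of \<open>L\<close> to consist of the constants and every other
  eigenvalue of \<open>- L\<close> to be at least \<open>m\<close>. As eigenvectors of distinct eigenvalues are orthogonal, there are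
  finitely many eigenvalues, so the defining description of \<open>eigenvalue_list\<close> is satisfied by an
  actual list. It starts with a single \<open>0\<close>, followed by \<open>m\<close>.
\<close>

lemma spectral_gap_eqI:
  assumes fin: "finite S" and sym: "symmetric_on S k"
    and L: "\<And>f x. x \<in> S \<Longrightarrow> L f x = generator S k f x"
    and m: "0 < m" and poin: "poincare S k m"
    and g: "\<exists>x\<in>S. g x \<noteq> 0" "\<And>x. x \<in> S \<Longrightarrow> generator S k g x = - m * g x"
  shows "spectral_gap S L = m"
proof -
  let ?A = "\<lambda>f x. - L f x"
  have E: "eigenspace S ?A l =
      {f. (\<forall>x. x \<notin> S \<longrightarrow> f x = 0) \<and> (\<forall>x\<in>S. generator S k f x = - l * f x)}" for l
    unfolding eigenspace_def using L by (auto simp: minus_equation_iff)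
  have energy: "dirichlet S k f h = l * (\<Sum>x\<in>S. f x * h x)" if "f \<in> eigenspace S ?A l" for f h l
    using that unfolding dirichlet_green[OF sym] E
    by (simp add: sum_distrib_left sum_negf[symmetric] mult_ac)
  have mean_zero: "sum f S = 0" if "f \<in> eigenspace S ?A l" "l \<noteq> 0" for f l
  proof -
    have "(\<Sum>x\<in>S. - l * f x) = 0"
      using generator_sum_zero[OF sym, of f] that(1) unfolding E by simp
    with that(2) show ?thesis by (simp add: sum_distrib_left[symmetric] sum_negf)
  qed
  have norm_pos: "0 < (\<Sum>x\<in>S. f x * f x)" if "f \<in> eigenspace S ?A l" "f \<noteq> 0" for f l
  proof -
    from that(2) obtain y where "f y \<noteq> 0" by (auto simp: fun_eq_iff)
    moreover from this have "y \<in> S" using that(1) by (auto simp: E)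
    ultimately show ?thesis using fin by (intro sum_pos2[of S y]) (auto simp: zero_less_mult_iff)
  qed
  have ev_ge: "m \<le> l" if "f \<in> eigenspace S ?A l" "f \<noteq> 0" "l \<noteq> 0" for f l
  proof -
    have "m * (\<Sum>x\<in>S. f x * f x) \<le> l * (\<Sum>x\<in>S. f x * f x)"
      using poin[unfolded poincare_def, rule_format, OF mean_zero[OF that(1,3)]]
        energy[OF that(1), of f]
      by (simp add: power2_eq_square)
    with norm_pos[OF that(1,2)] show ?thesis by simp
  qed
  have zero: "eigenspace S ?A 0 = range (\<lambda>a x. a * of_bool (x \<in> S))"
  proof (intro equalityI subsetI)
    fix f assume f: "f \<in> eigenspace S ?A 0"
    define a where "a = sum f S / card S"
    have "card S > 0" using g(1) fin by (auto simp: card_gt_0_iff)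
    then have "(\<Sum>x\<in>S. f x - a) = 0" by (simp add: sum_subtractf a_def)
    then have "m * (\<Sum>x\<in>S. (f x - a)\<^sup>2) \<le> dirichlet S k (\<lambda>x. f x - a) (\<lambda>x. f x - a)"
      using poin by (auto simp: poincare_def)
    also have "\<dots> = dirichlet S k f f" by (simp add: dirichlet_def)
    also have "\<dots> = 0" using energy[OF f] by simp
    finally have "(\<Sum>x\<in>S. (f x - a)\<^sup>2) = 0"
      using m by (simp add: mult_le_0_iff order_antisym sum_nonneg)
    then have "\<forall>x\<in>S. f x = a" using fin by (simp add: sum_nonneg_eq_0_iff)
    then have "f = (\<lambda>x. a * of_bool (x \<in> S))" using f by (auto simp: fun_eq_iff E)
    then show "f \<in> range (\<lambda>a x. a * of_bool (x \<in> S))" by blast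
  next
    fix f :: "'a \<Rightarrow> real" assume "f \<in> range (\<lambda>a x. a * of_bool (x \<in> S))"
    then show "f \<in> eigenspace S ?A 0" by (auto simp: E generator_def)
  qed
  define \<Lambda> where "\<Lambda> = {l. 0 < eig_multiplicity S ?A l}"
  have "finite \<Lambda>"
  proof -
    define e where "e l = (SOME f. f \<in> eigenspace S ?A l \<and> f \<noteq> 0)" for l
    have e: "e l \<in> eigenspace S ?A l" "e l \<noteq> 0" if "l \<in> \<Lambda>" for l
      using that someI_ex[of "\<lambda>f. f \<in> eigenspace S ?A l \<and> f \<noteq> 0"]
      by (auto simp: \<Lambda>_def e_def eig_multiplicity_pos_iff[OF fin])
    have orth: "(\<Sum>x\<in>S. e l x * e l' x) = 0" if "l \<in> \<Lambda>" "l' \<in> \<Lambda>" "l \<noteq> l'" for l l'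
    proof -
      have "dirichlet S k (e l) (e l') = dirichlet S k (e l') (e l)"
        by (simp add: dirichlet_def mult_ac)
      with energy[OF e(1)] that have "(l - l') * (\<Sum>x\<in>S. e l x * e l' x) = 0"
        by (simp add: algebra_simps)
      with that(3) show ?thesis by simp
    qed
    have inj: "inj_on e \<Lambda>"
    proof (rule inj_onI, rule ccontr)
      fix l l' assume l: "l \<in> \<Lambda>" "l' \<in> \<Lambda>" "e l = e l'" "l \<noteq> l'"
      with orth[OF l(1,2,4)] norm_pos[OF e[OF l(1)]] show False by simp
    qed
    have "finite (e ` \<Lambda>)"
    proof (rule finite_independent_supported[OF fin])
      show "\<not> module.dependent fun_scale (e ` \<Lambda>)"
        using orth norm_pos[OF e] by (intro independent_orthogonal[of _ S]) (fastforce+)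
      show "f x = 0" if "f \<in> e ` \<Lambda>" "x \<notin> S" for f x
        using that e(1) by (auto simp: E)
    qed
    then show ?thesis using inj by (rule finite_imageD)
  qed
  define ls where "ls = sorted_list_of_multiset (Abs_multiset (eig_multiplicity S ?A))"
  have count: "count_list ls l = eig_multiplicity S ?A l" for l
    using \<open>finite \<Lambda>\<close> unfolding ls_def \<Lambda>_def
    by (simp add: count_mset[symmetric] count_Abs_multiset)
  have "sorted ls" by (simp add: ls_def)
  then have gap: "spectral_gap S L = ls ! 1"
    using eigenvalue_list_eqI[OF _ count] by (simp add: spectral_gap_def)
  have mem: "l \<in> set ls \<longleftrightarrow> (\<exists>f\<in>eigenspace S ?A l. f \<noteq> 0)" for l
    using count[of l] eig_multiplicity_pos_iff[OF fin, of ?A l] by (metis count_list_0_iff gr0I less_numeral_extra(3))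
  have count0: "count_list ls 0 = 1"
    using count[of 0] eig_multiplicity_zero_constants[OF _ zero] g(1) by auto
  have nonneg: "l = 0 \<or> m \<le> l" if "l \<in> set ls" for l
    using that ev_ge by (auto simp: mem)
  have mls: "m \<in> set ls"
  proof -
    define g' where "g' x = (if x \<in> S then g x else 0)" for x
    have "generator S k g' x = generator S k g x" if "x \<in> S" for x
      using that by (simp add: generator_def g'_def)
    then have "g' \<in> eigenspace S ?A m" using g(2) by (auto simp: E g'_def)
    moreover have "g' \<noteq> 0" using g(1) by (auto simp: g'_def fun_eq_iff)
    ultimately show ?thesis unfolding mem by blast
  qed
  obtain a ls' where ls: "ls = a # ls'" using mls by (cases ls) auto
  have "a = 0"
  proof -
    have "0 \<in> set ls" using count0 by (metis count_list_0_iff zero_neq_one)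
    then have "a \<le> 0" using \<open>sorted ls\<close> ls by auto
    with nonneg[of a] ls m show ?thesis by auto
  qed
  with count0 ls have "0 \<notin> set ls'" by (auto simp: count_list_0_iff)
  moreover have "m \<in> set ls'" using mls ls \<open>a = 0\<close> m by simp
  moreover from this obtain b ls'' where ls': "ls' = b # ls''" by (cases ls') auto
  ultimately have "b \<noteq> 0" "b \<le> m" using \<open>sorted ls\<close> ls by auto
  with nonneg[of b] ls ls' have "b = m" by auto
  with gap ls ls' show ?thesis by simp
qed

section \<open>A computation in the group algebra of the symmetric group on five points\<close>

text \<open>
  Elements of the integral group ring of the permutations of \<open>{..<N}\<close>, written as lists of terms; a
  permutation is the list of its values. This representation is chosen to be evaluated by the
  simplifier.
\<close>

type_synonym formal_sum = "(int \<times> nat list) list"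

definition compose_list :: "nat list \<Rightarrow> nat list \<Rightarrow> nat list" where
  "compose_list p q = map ((!) p) q"

definition swap_list :: "nat \<Rightarrow> nat \<Rightarrow> nat \<Rightarrow> nat list" where
  "swap_list N a b = map (\<lambda>v. if v = a then b else if v = b then a else v) [0..<N]"

definition formal_mult :: "formal_sum \<Rightarrow> formal_sum \<Rightarrow> formal_sum" where
  "formal_mult xs ys = concat (map (\<lambda>(a, p). map (\<lambda>(b, q). (a * b, compose_list p q)) ys) xs)"

definition formal_scale :: "int \<Rightarrow> formal_sum \<Rightarrow> formal_sum" where
  "formal_scale a xs = map (\<lambda>(b, q). (a * b, q)) xs"

fun add_term :: "int \<Rightarrow> nat list \<Rightarrow> formal_sum \<Rightarrow> formal_sum" where
  "add_term a p [] = [(a, p)]"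
| "add_term a p ((b, q) # xs) = (if p = q then (a + b, q) # xs else (b, q) # add_term a p xs)"

definition collect_terms :: "formal_sum \<Rightarrow> formal_sum" where
  "collect_terms xs = filter (\<lambda>(a, p). a \<noteq> 0) (foldr (\<lambda>(a, p). add_term a p) xs [])"

text \<open>
  The element \<open>1 + \<tau>\<^sub>i\<^sub>j - \<tau>\<^sub>0\<^sub>i - \<tau>\<^sub>0\<^sub>j\<close>; the point \<open>0\<close> stands for the removed vertex.
\<close>

definition pair_formal :: "nat \<Rightarrow> nat \<Rightarrow> nat \<Rightarrow> formal_sum" where
  "pair_formal N i j =
     [(1, swap_list N 0 0), (1, swap_list N i j), (-1, swap_list N 0 i), (-1, swap_list N 0 j)]"

text \<open>
  The coefficient of \<open>a\<^sub>i a\<^sub>j a\<^sub>k a\<^sub>l\<close> in \<open>2 s P - P\<^sup>2\<close>, before symmetrisation.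
\<close>

definition quad_formal :: "nat \<Rightarrow> nat \<Rightarrow> nat \<Rightarrow> nat \<Rightarrow> nat \<Rightarrow> formal_sum" where
  "quad_formal N i j k l =
     formal_scale (2 * (1 + of_bool (i = j))) (pair_formal N k l) @
     formal_scale (-1) (formal_mult (pair_formal N i j) (pair_formal N k l))"

text \<open>
  One term for each ordered way of splitting the four indices into two pairs. Exchanging the members
  of a pair does not change the element of the group ring, so up to
  a factor \<open>4\<close> these six terms make up
  the sum over all permutations of the indices.
\<close>

definition sym_quad_formal :: "nat \<Rightarrow> nat \<Rightarrow> nat \<Rightarrow> nat \<Rightarrow> nat \<Rightarrow> formal_sum" where
  "sym_quad_formal N i j k l =
     quad_formal N i j k l @ quad_formal N k l i j @ quad_formal N i k j l @
     quad_formal N j l i k @ quad_formal N i l j k @ quad_formal N j k i l"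

definition formal_wf :: "nat \<Rightarrow> formal_sum \<Rightarrow> bool" where
  "formal_wf N xs = list_all (\<lambda>(a, p). length p = N \<and> list_all (\<lambda>v. v < N) p) xs"

definition square_check :: "nat \<Rightarrow> nat \<Rightarrow> nat \<Rightarrow> nat \<Rightarrow> nat \<Rightarrow> bool" where
  "square_check N i j k l =
     (let w = collect_terms (sym_quad_formal N i j k l)
      in formal_wf N w \<and> collect_terms (formal_mult w w @ formal_scale (-24) w) = [])"

text \<open>
  One representative, together with the number of points involved, for each of the fifteen ways in which
  four indices different from \<open>0\<close> can coincide.
\<close>

definition square_patterns :: "(nat \<times> nat \<times> nat \<times> nat \<times> nat) list" where
  "square_patterns =
    [(2,1,1,1,1),
     (3,1,1,1,2), (3,1,1,2,1), (3,1,2,1,1), (3,1,2,2,2),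
     (3,1,1,2,2), (3,1,2,1,2), (3,1,2,2,1),
     (4,1,1,2,3), (4,1,2,1,3), (4,1,2,3,1), (4,1,2,2,3), (4,1,2,3,2), (4,1,2,3,3),
     (5,1,2,3,4)]"

text \<open>
  Representation theory explains the result. Denote by \<open>K\<close> and \<open>V\<close> the sums of all 3-cycles and
  of all double transpositions of \<open>A\<^sub>5\<close>, and by \<open>K'\<close> and \<open>V'\<close> those of the copy of \<open>A\<^sub>4\<close> fixing \<open>0\<close>. For four
  distinct indices the element is \<open>W = 2 (3 - (K - K') + V - 2 V')\<close>. These class sums act as scalars on each
  irreducible representation of \<open>S\<^sub>4\<close> inside one of \<open>S\<^sub>5\<close>, and the scalar of \<open>W\<close> is \<open>0\<close> except on
  the component of shape \<open>(3,1)\<close> in shape \<open>(3,2)\<close> and its twist by the sign, where it is \<open>24\<close>. If there are exactly three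
  distinct indices then \<open>W = 4 - 2 K + 4 V\<close>, with the class sums of \<open>A\<^sub>4\<close> on the four points
  involved. Its scalar is \<open>24\<close> on the two nontrivial one-dimensional representations of \<open>A\<^sub>4\<close> and \<open>0\<close> on the others.
  With fewer distinct indices \<open>W\<close> vanishes.
\<close>

lemma square_check_patterns:
  "\<forall>(N, i, j, k, l) \<in> set square_patterns. square_check N i j k l"
  by code_simp

text \<open>
  The permutation of the ambient type that acts on the image of \<open>e\<close> like the list \<open>p\<close> acts on \<open>{..<N}\<close>.
\<close>

definition perm_of :: "nat \<Rightarrow> (nat \<Rightarrow> 'a) \<Rightarrow> nat list \<Rightarrow> 'a \<Rightarrow> 'a" where
  "perm_of N e p v = (if v \<in> e ` {..<N} then e (p ! the_inv_into {..<N} e v) else v)"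

definition formal_value ::
    "nat \<Rightarrow> (nat \<Rightarrow> 'a) \<Rightarrow> formal_sum \<Rightarrow> (('a \<Rightarrow> 'a) \<Rightarrow> real) \<Rightarrow> ('a \<Rightarrow> 'a) \<Rightarrow> real" where
  "formal_value N e xs f \<eta> = (\<Sum>(a, p)\<leftarrow>xs. of_int a * f (\<eta> \<circ> perm_of N e p))"

lemma perm_of_image:
  assumes "inj_on e {..<N}" "a < N"
  shows "perm_of N e p (e a) = e (p ! a)"
  using assms by (simp add: perm_of_def the_inv_into_f_f)

lemma perm_of_compose:
  assumes e: "inj_on e {..<N}" and q: "length q = N" "\<forall>v\<in>set q. v < N"
  shows "perm_of N e p \<circ> perm_of N e q = perm_of N e (compose_list p q)"
proof
  fix v
  show "(perm_of N e p \<circ> perm_of N e q) v = perm_of N e (compose_list p q) v"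
  proof (cases "v \<in> e ` {..<N}")
    case True
    then obtain a where a: "a < N" "v = e a" by auto
    with q have "q ! a < N" by simp
    with a q e show ?thesis
      by (simp add: perm_of_image compose_list_def)
  next
    case False
    then show ?thesis by (simp add: perm_of_def)
  qed
qed

lemma perm_of_swap_list:
  assumes e: "inj_on e {..<N}" and "a < N" "b < N"
  shows "perm_of N e (swap_list N a b) = transpose (e a) (e b)"
proof
  fix v
  show "perm_of N e (swap_list N a b) v = transpose (e a) (e b) v"
  proof (cases "v \<in> e ` {..<N}")
    case True
    then obtain u where u: "u < N" "v = e u" by auto
    with assms show ?thesis
      by (auto simp: perm_of_image swap_list_def transpose_def inj_on_eq_iff)
  next
    case False
    with assms have "v \<noteq> e a" "v \<noteq> e b" by auto
    with False show ?thesis by (simp add: perm_of_def transpose_def)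
  qed
qed

lemma formal_value_simps [simp]:
  "formal_value N e [] f \<eta> = 0"
  "formal_value N e ((a, p) # xs) f \<eta> = of_int a * f (\<eta> \<circ> perm_of N e p) + formal_value N e xs f \<eta>"
  "formal_value N e (xs @ ys) f \<eta> = formal_value N e xs f \<eta> + formal_value N e ys f \<eta>"
  by (simp_all add: formal_value_def)

lemma formal_value_scale:
  "formal_value N e (formal_scale a xs) f \<eta> = of_int a * formal_value N e xs f \<eta>"
  by (induction xs) (auto simp: formal_scale_def algebra_simps)

text \<open>
  Acting by composition on the right makes \<open>formal_value\<close> a left action of the group ring, so that the
  multiplication of formal sums is the composition of operators.
\<close>

lemma formal_value_mult:
  assumes e: "inj_on e {..<N}" and wf: "formal_wf N ys"
  shows "formal_value N e (formal_mult xs ys) f \<eta> =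
         formal_value N e xs (\<lambda>\<zeta>. formal_value N e ys f \<zeta>) \<eta>"
proof (induction xs)
  case Nil
  then show ?case by (simp add: formal_mult_def)
next
  case (Cons x xs)
  obtain a p where x: "x = (a, p)" by force
  have "formal_value N e (map (\<lambda>(b, q). (a * b, compose_list p q)) ys) f \<eta> =
      of_int a * formal_value N e ys f (\<eta> \<circ> perm_of N e p)"
    using wf
  proof (induction ys)
    case Nil
    then show ?case by simp
  next
    case (Cons y ys)
    obtain b q where y: "y = (b, q)" by force
    with Cons.prems have "length q = N" "\<forall>v\<in>set q. v < N"
      by (auto simp: formal_wf_def list_all_iff)
    with perm_of_compose[OF e this]
    have "perm_of N e p (perm_of N e q v) = perm_of N e (compose_list p q) v" for v
      by (metis comp_apply)
    with Cons y show ?case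
      by (simp add: formal_wf_def algebra_simps comp_def)
  qed
  with Cons x show ?case by (simp add: formal_mult_def)
qed

lemma formal_value_collect_terms:
  "formal_value N e (collect_terms xs) f \<eta> = formal_value N e xs f \<eta>"
proof -
  have filter: "formal_value N e (filter (\<lambda>(a, p). a \<noteq> 0) ys) f \<eta> = formal_value N e ys f \<eta>" for ys
    by (induction ys) (auto simp: comp_def)
  have add: "formal_value N e (add_term a p ys) f \<eta> =
      of_int a * f (\<eta> \<circ> perm_of N e p) + formal_value N e ys f \<eta>" for a p ys
    by (induction a p ys rule: add_term.induct) (auto simp: algebra_simps comp_def)
  have "formal_value N e (foldr (\<lambda>(a, p). add_term a p) xs []) f \<eta> = formal_value N e xs f \<eta>"
    by (induction xs) (auto simp: add)
  then show ?thesis by (simp add: collect_terms_def filter)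
qed

definition pair_op :: "'a \<Rightarrow> 'a \<Rightarrow> 'a \<Rightarrow> (('a \<Rightarrow> 'a) \<Rightarrow> real) \<Rightarrow> ('a \<Rightarrow> 'a) \<Rightarrow> real" where
  "pair_op x i j f \<eta> = f \<eta> + f (\<eta> \<circ> transpose i j)
     - f (\<eta> \<circ> transpose x i) - f (\<eta> \<circ> transpose x j)"

definition quad_op ::
    "'a \<Rightarrow> 'a \<Rightarrow> 'a \<Rightarrow> 'a \<Rightarrow> 'a \<Rightarrow> (('a \<Rightarrow> 'a) \<Rightarrow> real) \<Rightarrow> ('a \<Rightarrow> 'a) \<Rightarrow> real" where
  "quad_op x i j k l f \<eta> =
     2 * (1 + of_bool (i = j)) * pair_op x k l f \<eta> - pair_op x i j (pair_op x k l f) \<eta>"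

definition sym_quad_op ::
    "'a \<Rightarrow> 'a \<Rightarrow> 'a \<Rightarrow> 'a \<Rightarrow> 'a \<Rightarrow> (('a \<Rightarrow> 'a) \<Rightarrow> real) \<Rightarrow> ('a \<Rightarrow> 'a) \<Rightarrow> real" where
  "sym_quad_op x i j k l f \<eta> =
     quad_op x i j k l f \<eta> + quad_op x k l i j f \<eta> + quad_op x i k j l f \<eta> +
     quad_op x j l i k f \<eta> + quad_op x i l j k f \<eta> + quad_op x j k i l f \<eta>"

lemma pair_op_eq_formal_value:
  assumes "inj_on e {..<N}" "i < N" "j < N"
  shows "pair_op (e 0) (e i) (e j) f = formal_value N e (pair_formal N i j) f"
  using assms by (simp add: fun_eq_iff pair_op_def pair_formal_def perm_of_swap_list)

lemma formal_wf_pair_formal: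
  assumes "i < N" "j < N"
  shows "formal_wf N (pair_formal N i j)"
  using assms by (auto simp: formal_wf_def pair_formal_def swap_list_def list_all_iff)

lemma quad_op_eq_formal_value:
  assumes "inj_on e {..<N}" "i < N" "j < N" "k < N" "l < N"
  shows "quad_op (e 0) (e i) (e j) (e k) (e l) f = formal_value N e (quad_formal N i j k l) f"
  using assms
  by (simp add: fun_eq_iff quad_op_def quad_formal_def formal_value_scale pair_op_eq_formal_value
      formal_value_mult formal_wf_pair_formal inj_on_eq_iff)

lemma sym_quad_op_eq_formal_value:
  assumes "inj_on e {..<N}" "i < N" "j < N" "k < N" "l < N"
  shows "sym_quad_op (e 0) (e i) (e j) (e k) (e l) f =
    formal_value N e (collect_terms (sym_quad_formal N i j k l)) f"
  using assms
  by (simp add: fun_eq_iff sym_quad_op_def sym_quad_formal_def quad_op_eq_formal_value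
      formal_value_collect_terms)

lemma sym_quad_op_square_pattern:
  assumes e: "inj_on e {..<N}" and pat: "(N, i, j, k, l) \<in> set square_patterns"
  defines "W \<equiv> sym_quad_op (e 0) (e i) (e j) (e k) (e l)"
  shows "W (W f) \<eta> = 24 * W f \<eta>"
proof -
  define w where "w = collect_terms (sym_quad_formal N i j k l)"
  have less: "i < N" "j < N" "k < N" "l < N"
    using pat by (auto simp: square_patterns_def)
  have W: "W g = formal_value N e w g" for g
    unfolding W_def w_def by (rule sym_quad_op_eq_formal_value[OF e less])
  have "square_check N i j k l"
    using square_check_patterns pat by blast
  then have wf: "formal_wf N w"
    and zero: "collect_terms (formal_mult w w @ formal_scale (-24) w) = []"
    by (simp_all add: square_check_def Let_def w_def)
  have "0 = formal_value N e (formal_mult w w @ formal_scale (-24) w) f \<eta>"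
    by (metis zero formal_value_collect_terms formal_value_simps(1))
  also have "\<dots> = W (W f) \<eta> - 24 * W f \<eta>"
    by (simp add: formal_value_mult[OF e wf] formal_value_scale W)
  finally show ?thesis by simp
qed

text \<open>
  The points \<open>x, i, j, k, l\<close> are labelled so that their coincidences match one of the checked patterns;
  the list in each case enumerates the distinct points.
\<close>

lemma sym_quad_op_square:
  assumes "x \<notin> {i, j, k, l}"
  shows "sym_quad_op x i j k l (sym_quad_op x i j k l f) \<eta> = 24 * sym_quad_op x i j k l f \<eta>"
proof -
  have pattern: ?thesis
    if "distinct xs" "xs ! 0 = x" "xs ! a = i" "xs ! b = j" "xs ! c = k" "xs ! d = l"
      "(length xs, a, b, c, d) \<in> set square_patterns" for xs a b c d
  proof -
    have "inj_on ((!) xs) {..<length xs}"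
      using that(1) by (simp add: inj_on_nth)
    from sym_quad_op_square_pattern[OF this that(7)] show ?thesis
      by (simp only: that(2-6))
  qed
  consider "i = j" "i = k" "i = l" | "i = j" "i = k" "i \<noteq> l" | "i = j" "i \<noteq> k" "i = l"
    | "i = j" "i \<noteq> k" "k = l" | "i = j" "i \<noteq> k" "i \<noteq> l" "k \<noteq> l"
    | "i \<noteq> j" "i = k" "i = l" | "i \<noteq> j" "i = k" "j = l" | "i \<noteq> j" "i = k" "i \<noteq> l" "j \<noteq> l"
    | "i \<noteq> j" "j = k" "i = l" | "i \<noteq> j" "j = k" "j = l" | "i \<noteq> j" "j = k" "i \<noteq> l" "j \<noteq> l"
    | "i \<noteq> j" "i \<noteq> k" "j \<noteq> k" "i = l" | "i \<noteq> j" "i \<noteq> k" "j \<noteq> k" "j = l"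
    | "i \<noteq> j" "i \<noteq> k" "j \<noteq> k" "k = l"
    | "i \<noteq> j" "i \<noteq> k" "j \<noteq> k" "i \<noteq> l" "j \<noteq> l" "k \<noteq> l"
    by blast
  then show ?thesis
  proof cases
    case 1 then show ?thesis
      using assms by (intro pattern[of "[x,i]" 1 1 1 1]) (auto simp: square_patterns_def)
  next
    case 2 then show ?thesis
      using assms by (intro pattern[of "[x,i,l]" 1 1 1 2]) (auto simp: square_patterns_def)
  next
    case 3 then show ?thesis
      using assms by (intro pattern[of "[x,i,k]" 1 1 2 1]) (auto simp: square_patterns_def)
  next
    case 4 then show ?thesis
      using assms by (intro pattern[of "[x,i,k]" 1 1 2 2]) (auto simp: square_patterns_def)
  next
    case 5 then show ?thesis
      using assms by (intro pattern[of "[x,i,k,l]" 1 1 2 3]) (auto simp: square_patterns_def)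
  next
    case 6 then show ?thesis
      using assms by (intro pattern[of "[x,i,j]" 1 2 1 1]) (auto simp: square_patterns_def)
  next
    case 7 then show ?thesis
      using assms by (intro pattern[of "[x,i,j]" 1 2 1 2]) (auto simp: square_patterns_def)
  next
    case 8 then show ?thesis
      using assms by (intro pattern[of "[x,i,j,l]" 1 2 1 3]) (auto simp: square_patterns_def)
  next
    case 9 then show ?thesis
      using assms by (intro pattern[of "[x,i,j]" 1 2 2 1]) (auto simp: square_patterns_def)
  next
    case 10 then show ?thesis
      using assms by (intro pattern[of "[x,i,j]" 1 2 2 2]) (auto simp: square_patterns_def)
  next
    case 11 then show ?thesis
      using assms by (intro pattern[of "[x,i,j,l]" 1 2 2 3]) (auto simp: square_patterns_def)
  next
    case 12 then show ?thesis
      using assms by (intro pattern[of "[x,i,j,k]" 1 2 3 1]) (auto simp: square_patterns_def)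
  next
    case 13 then show ?thesis
      using assms by (intro pattern[of "[x,i,j,k]" 1 2 3 2]) (auto simp: square_patterns_def)
  next
    case 14 then show ?thesis
      using assms by (intro pattern[of "[x,i,j,k]" 1 2 3 3]) (auto simp: square_patterns_def)
  next
    case 15 then show ?thesis
      using assms by (intro pattern[of "[x,i,j,k,l]" 1 2 3 4]) (auto simp: square_patterns_def)
  qed
qed

section \<open>The octopus inequality\<close>

definition perm_inner ::
    "'a set \<Rightarrow> (('a \<Rightarrow> 'a) \<Rightarrow> real) \<Rightarrow> (('a \<Rightarrow> 'a) \<Rightarrow> real) \<Rightarrow> real" where
  "perm_inner S f g = (\<Sum>\<eta> | \<eta> permutes S. f \<eta> * g \<eta>)"

definition swap_energy :: "'a set \<Rightarrow> 'a \<Rightarrow> 'a \<Rightarrow> (('a \<Rightarrow> 'a) \<Rightarrow> real) \<Rightarrow> real" where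
  "swap_energy S y z f = (\<Sum>\<eta> | \<eta> permutes S. (f (\<eta> \<circ> transpose y z) - f \<eta>)\<^sup>2)"

lemma sum_perm_swap:
  assumes "i \<in> S" "j \<in> S"
  shows "(\<Sum>\<eta> | \<eta> permutes S. h (\<eta> \<circ> transpose i j)) = (\<Sum>\<eta> | \<eta> permutes S. h \<eta>)"
  using sum_permutations_compose_right[OF permutes_swap_id[OF assms], of h] by simp

lemma perm_inner_swap:
  assumes "i \<in> S" "j \<in> S"
  shows "perm_inner S (\<lambda>\<eta>. f (\<eta> \<circ> transpose i j)) g = perm_inner S f (\<lambda>\<eta>. g (\<eta> \<circ> transpose i j))"
  unfolding perm_inner_def
  using sum_perm_swap[OF assms, of "\<lambda>\<eta>. f \<eta> * g (\<eta> \<circ> transpose i j)"]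
  by (simp add: comp_assoc)

lemma perm_inner_linear:
  "perm_inner S (\<lambda>\<eta>. f \<eta> + g \<eta>) h = perm_inner S f h + perm_inner S g h"
  "perm_inner S (\<lambda>\<eta>. f \<eta> - g \<eta>) h = perm_inner S f h - perm_inner S g h"
  "perm_inner S (\<lambda>\<eta>. b * f \<eta>) h = b * perm_inner S f h"
  "perm_inner S h (\<lambda>\<eta>. f \<eta> + g \<eta>) = perm_inner S h f + perm_inner S h g"
  "perm_inner S h (\<lambda>\<eta>. f \<eta> - g \<eta>) = perm_inner S h f - perm_inner S h g"
  "perm_inner S h (\<lambda>\<eta>. b * f \<eta>) = b * perm_inner S h f"
  by (simp_all add: perm_inner_def algebra_simps sum.distrib sum_subtractf sum_distrib_left)

lemma pair_op_self_adjoint: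
  assumes "x \<in> S" "i \<in> S" "j \<in> S"
  shows "perm_inner S (pair_op x i j f) g = perm_inner S f (pair_op x i j g)"
proof -
  have P: "pair_op x i j h = (\<lambda>\<eta>. h \<eta> + h (\<eta> \<circ> transpose i j)
     - h (\<eta> \<circ> transpose x i) - h (\<eta> \<circ> transpose x j))" for h
    by (simp add: fun_eq_iff pair_op_def)
  show ?thesis
    unfolding P perm_inner_linear using assms by (simp only: perm_inner_swap)
qed

text \<open>
  The adjoint contains the product of the two pair operators in the opposite order. A single
  \<open>quad_op\<close> is therefore not
  self-adjoint, but the symmetrised operator is.
\<close>

lemma perm_inner_quad_op:
  assumes "x \<in> S" "i \<in> S" "j \<in> S" "k \<in> S" "l \<in> S"
  shows "perm_inner S f (quad_op x i j k l g) =
      2 * (1 + of_bool (i = j)) * perm_inner S f (pair_op x k l g)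
        - perm_inner S (pair_op x i j f) (pair_op x k l g)"
    and "perm_inner S (quad_op x i j k l f) g =
      2 * (1 + of_bool (i = j)) * perm_inner S f (pair_op x k l g)
        - perm_inner S (pair_op x k l f) (pair_op x i j g)"
proof -
  have Q: "quad_op x i j k l h = (\<lambda>\<eta>. 2 * (1 + of_bool (i = j)) * pair_op x k l h \<eta>
      - pair_op x i j (pair_op x k l h) \<eta>)" for h
    by (simp add: fun_eq_iff quad_op_def)
  show "perm_inner S f (quad_op x i j k l g) =
      2 * (1 + of_bool (i = j)) * perm_inner S f (pair_op x k l g)
        - perm_inner S (pair_op x i j f) (pair_op x k l g)"
    unfolding Q perm_inner_linear using assms by (simp only: pair_op_self_adjoint)
  show "perm_inner S (quad_op x i j k l f) g =
      2 * (1 + of_bool (i = j)) * perm_inner S f (pair_op x k l g)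
        - perm_inner S (pair_op x k l f) (pair_op x i j g)"
    unfolding Q perm_inner_linear using assms by (simp only: pair_op_self_adjoint)
qed

lemma perm_inner_sym_quad_op:
  "perm_inner S f (sym_quad_op x i j k l g) =
     perm_inner S f (quad_op x i j k l g) + perm_inner S f (quad_op x k l i j g) +
     perm_inner S f (quad_op x i k j l g) + perm_inner S f (quad_op x j l i k g) +
     perm_inner S f (quad_op x i l j k g) + perm_inner S f (quad_op x j k i l g)"
  "perm_inner S (sym_quad_op x i j k l f) g =
     perm_inner S (quad_op x i j k l f) g + perm_inner S (quad_op x k l i j f) g +
     perm_inner S (quad_op x i k j l f) g + perm_inner S (quad_op x j l i k f) g +
     perm_inner S (quad_op x i l j k f) g + perm_inner S (quad_op x j k i l f) g"
proof -
  have Q: "sym_quad_op x i j k l h = (\<lambda>\<eta>.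
     quad_op x i j k l h \<eta> + quad_op x k l i j h \<eta> + quad_op x i k j l h \<eta> +
     quad_op x j l i k h \<eta> + quad_op x i l j k h \<eta> + quad_op x j k i l h \<eta>)" for h
    by (simp add: fun_eq_iff sym_quad_op_def)
  show "perm_inner S f (sym_quad_op x i j k l g) =
     perm_inner S f (quad_op x i j k l g) + perm_inner S f (quad_op x k l i j g) +
     perm_inner S f (quad_op x i k j l g) + perm_inner S f (quad_op x j l i k g) +
     perm_inner S f (quad_op x i l j k g) + perm_inner S f (quad_op x j k i l g)"
    unfolding Q perm_inner_linear ..
  show "perm_inner S (sym_quad_op x i j k l f) g =
     perm_inner S (quad_op x i j k l f) g + perm_inner S (quad_op x k l i j f) g +
     perm_inner S (quad_op x i k j l f) g + perm_inner S (quad_op x j l i k f) g +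
     perm_inner S (quad_op x i l j k f) g + perm_inner S (quad_op x j k i l f) g"
    unfolding Q perm_inner_linear ..
qed

lemma sym_quad_op_self_adjoint:
  assumes "x \<in> S" "i \<in> S" "j \<in> S" "k \<in> S" "l \<in> S"
  shows "perm_inner S (sym_quad_op x i j k l f) g = perm_inner S f (sym_quad_op x i j k l g)"
  unfolding perm_inner_sym_quad_op using assms by (simp add: perm_inner_quad_op)

text \<open>
  A self-adjoint \<open>W\<close> with \<open>W\<^sup>2 = 24 W\<close> satisfies \<open>24 \<langle>f, W f\<rangle> = \<parallel>W f\<parallel>\<^sup>2\<close>.
\<close>

lemma sym_quad_form_nonneg:
  assumes "x \<in> S" "i \<in> S" "j \<in> S" "k \<in> S" "l \<in> S" and "x \<notin> {i, j, k, l}"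
  shows "0 \<le> perm_inner S f (sym_quad_op x i j k l f)"
proof -
  let ?W = "sym_quad_op x i j k l"
  have "?W (?W f) = (\<lambda>\<eta>. 24 * ?W f \<eta>)"
    using sym_quad_op_square[OF assms(6)] by (simp add: fun_eq_iff)
  then have "24 * perm_inner S f (?W f) = perm_inner S f (?W (?W f))"
    by (simp add: perm_inner_linear)
  also have "\<dots> = perm_inner S (?W f) (?W f)"
    using assms by (simp add: sym_quad_op_self_adjoint)
  also have "\<dots> \<ge> 0"
    by (simp add: perm_inner_def sum_nonneg)
  finally show ?thesis by simp
qed

text \<open>
  The weight \<open>a\<^sub>i a\<^sub>j a\<^sub>k a\<^sub>l\<close> is invariant under permutations of the indices, so the sum does not change when
  each summand is replaced by its average over the six splittings into pairs.
\<close>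

lemma quad_form_sum_nonneg:
  assumes x: "x \<in> S" "x \<notin> V" and V: "V \<subseteq> S"
    and a: "\<And>i. i \<in> V \<Longrightarrow> 0 \<le> a i"
  shows "0 \<le> (\<Sum>(i, j, k, l) \<in> V \<times> V \<times> V \<times> V.
    a i * a j * a k * a l * perm_inner S f (quad_op x i j k l f))"
proof -
  let ?Q = "V \<times> V \<times> V \<times> V"
  define D where "D i j k l = perm_inner S f (quad_op x i j k l f)" for i j k l
  define T where "T = (\<Sum>(i, j, k, l) \<in> ?Q. a i * a j * a k * a l * D i j k l)"
  have 2: "(\<Sum>(i, j, k, l) \<in> ?Q. a i * a j * a k * a l * D k l i j) = T"
    unfolding T_def
    by (rule sum.reindex_bij_witness[where i = "\<lambda>(i, j, k, l). (k, l, i, j)"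
          and j = "\<lambda>(i, j, k, l). (k, l, i, j)"]) (auto simp: algebra_simps)
  have 3: "(\<Sum>(i, j, k, l) \<in> ?Q. a i * a j * a k * a l * D i k j l) = T"
    unfolding T_def
    by (rule sum.reindex_bij_witness[where i = "\<lambda>(i, j, k, l). (i, k, j, l)"
          and j = "\<lambda>(i, j, k, l). (i, k, j, l)"]) (auto simp: algebra_simps)
  have 4: "(\<Sum>(i, j, k, l) \<in> ?Q. a i * a j * a k * a l * D j l i k) = T"
    unfolding T_def
    by (rule sum.reindex_bij_witness[where i = "\<lambda>(i, j, k, l). (k, i, l, j)"
          and j = "\<lambda>(i, j, k, l). (j, l, i, k)"]) (auto simp: algebra_simps)
  have 5: "(\<Sum>(i, j, k, l) \<in> ?Q. a i * a j * a k * a l * D i l j k) = T"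
    unfolding T_def
    by (rule sum.reindex_bij_witness[where i = "\<lambda>(i, j, k, l). (i, k, l, j)"
          and j = "\<lambda>(i, j, k, l). (i, l, j, k)"]) (auto simp: algebra_simps)
  have 6: "(\<Sum>(i, j, k, l) \<in> ?Q. a i * a j * a k * a l * D j k i l) = T"
    unfolding T_def
    by (rule sum.reindex_bij_witness[where i = "\<lambda>(i, j, k, l). (k, i, j, l)"
          and j = "\<lambda>(i, j, k, l). (j, k, i, l)"]) (auto simp: algebra_simps)
  have "0 \<le> (\<Sum>(i, j, k, l) \<in> ?Q. a i * a j * a k * a l *
      (D i j k l + D k l i j + D i k j l + D j l i k + D i l j k + D j k i l))"
  proof (rule sum_nonneg, clarify)
    fix i j k l assume ijkl: "i \<in> V" "j \<in> V" "k \<in> V" "l \<in> V"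
    then have "0 \<le> perm_inner S f (sym_quad_op x i j k l f)"
      using x V by (intro sym_quad_form_nonneg) auto
    then have "0 \<le> D i j k l + D k l i j + D i k j l + D j l i k + D i l j k + D j k i l"
      by (simp add: perm_inner_sym_quad_op D_def)
    with ijkl a show "0 \<le> a i * a j * a k * a l *
      (D i j k l + D k l i j + D i k j l + D j l i k + D i l j k + D j k i l)"
      by (intro mult_nonneg_nonneg) auto
  qed
  also have "\<dots> = (\<Sum>(i, j, k, l) \<in> ?Q. a i * a j * a k * a l * D i j k l)
      + (\<Sum>(i, j, k, l) \<in> ?Q. a i * a j * a k * a l * D k l i j)
      + (\<Sum>(i, j, k, l) \<in> ?Q. a i * a j * a k * a l * D i k j l)
      + (\<Sum>(i, j, k, l) \<in> ?Q. a i * a j * a k * a l * D j l i k)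
      + (\<Sum>(i, j, k, l) \<in> ?Q. a i * a j * a k * a l * D i l j k)
      + (\<Sum>(i, j, k, l) \<in> ?Q. a i * a j * a k * a l * D j k i l)"
    by (simp add: case_prod_unfold distrib_left sum.distrib)
  also have "\<dots> = 6 * T"
    unfolding 2 3 4 5 6 by (simp add: T_def)
  finally show ?thesis by (simp add: T_def D_def)
qed

lemma sum_pairs_product:
  fixes F G :: "'a \<Rightarrow> 'a \<Rightarrow> real"
  shows "(\<Sum>(i, j) \<in> V \<times> V. F i j) * (\<Sum>(k, l) \<in> V \<times> V. G k l) =
    (\<Sum>(i, j, k, l) \<in> V \<times> V \<times> V \<times> V. F i j * G k l)"
proof -
  have "(\<Sum>(i, j) \<in> V \<times> V. F i j) * (\<Sum>(k, l) \<in> V \<times> V. G k l) =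
      (\<Sum>i\<in>V. \<Sum>j\<in>V. F i j) * (\<Sum>k\<in>V. \<Sum>l\<in>V. G k l)"
    by (simp only: sum.cartesian_product)
  also have "\<dots> = (\<Sum>i\<in>V. \<Sum>j\<in>V. F i j * (\<Sum>k\<in>V. \<Sum>l\<in>V. G k l))"
    by (simp only: sum_distrib_right)
  also have "\<dots> = (\<Sum>i\<in>V. \<Sum>j\<in>V. \<Sum>k\<in>V. \<Sum>l\<in>V. F i j * G k l)"
    by (simp only: sum_distrib_left)
  finally show ?thesis
    by (simp only: sum.cartesian_product)
qed

text \<open>
  With \<open>h = P f\<close> the quartic form is \<open>2 s \<langle>f, P f\<rangle> - \<parallel>h\<parallel>\<^sup>2 \<ge> 0\<close>, and \<open>s > 0\<close> unless all weights vanish.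
\<close>

lemma pair_form_sum_nonneg:
  assumes fin: "finite V" and x: "x \<in> S" "x \<notin> V" and V: "V \<subseteq> S"
    and a: "\<And>i. i \<in> V \<Longrightarrow> 0 \<le> a i"
  shows "0 \<le> (\<Sum>(i, j) \<in> V \<times> V. a i * a j * perm_inner S f (pair_op x i j f))"
proof (cases "\<forall>i\<in>V. a i = 0")
  case True
  then have "(\<Sum>(i, j) \<in> V \<times> V. a i * a j * perm_inner S f (pair_op x i j f)) = 0"
    by (intro sum.neutral) auto
  then show ?thesis by simp
next
  case False
  then obtain i0 where i0: "i0 \<in> V" "a i0 \<noteq> 0" by blast
  define s where "s = (\<Sum>(i, j) \<in> V \<times> V. a i * a j * (1 + of_bool (i = j)))"
  define P where "P = (\<Sum>(i, j) \<in> V \<times> V. a i * a j * perm_inner S f (pair_op x i j f))"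
  define h where "h \<eta> = (\<Sum>(i, j) \<in> V \<times> V. a i * a j * pair_op x i j f \<eta>)" for \<eta>
  have "0 < s"
    unfolding s_def
  proof (rule sum_pos2)
    show "(i0, i0) \<in> V \<times> V" "finite (V \<times> V)" using i0 fin by auto
    show "0 < (case (i0, i0) of (i, j) \<Rightarrow> a i * a j * (1 + of_bool (i = j)))"
      using i0 a[of i0] by simp
    show "0 \<le> (case p of (i, j) \<Rightarrow> a i * a j * (1 + of_bool (i = j)))" if "p \<in> V \<times> V" for p
      using that a by auto
  qed
  have sP: "2 * s * P = (\<Sum>(i, j, k, l) \<in> V \<times> V \<times> V \<times> V. a i * a j * a k * a l *
      (2 * (1 + of_bool (i = j)) * perm_inner S f (pair_op x k l f)))"
    unfolding s_def P_def mult.assoc sum_pairs_product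
    by (simp add: sum_distrib_left case_prod_unfold mult_ac)
  have hh: "perm_inner S h h = (\<Sum>(i, j, k, l) \<in> V \<times> V \<times> V \<times> V. a i * a j * a k * a l *
      perm_inner S (pair_op x i j f) (pair_op x k l f))"
  proof -
    have "h \<eta> * h \<eta> = (\<Sum>(i, j, k, l) \<in> V \<times> V \<times> V \<times> V. a i * a j * a k * a l *
      (pair_op x i j f \<eta> * pair_op x k l f \<eta>))" for \<eta>
      unfolding h_def sum_pairs_product by (simp add: mult_ac)
    then have "perm_inner S h h = (\<Sum>\<eta> | \<eta> permutes S. \<Sum>(i, j, k, l) \<in> V \<times> V \<times> V \<times> V.
        a i * a j * a k * a l * (pair_op x i j f \<eta> * pair_op x k l f \<eta>))"
      by (simp add: perm_inner_def)
    also have "\<dots> = (\<Sum>(i, j, k, l) \<in> V \<times> V \<times> V \<times> V. \<Sum>\<eta> | \<eta> permutes S.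
        a i * a j * a k * a l * (pair_op x i j f \<eta> * pair_op x k l f \<eta>))"
      by (subst sum.swap) (simp add: case_prod_unfold)
    finally show ?thesis
      by (simp add: perm_inner_def sum_distrib_left)
  qed
  have "0 \<le> (\<Sum>(i, j, k, l) \<in> V \<times> V \<times> V \<times> V.
    a i * a j * a k * a l * perm_inner S f (quad_op x i j k l f))"
    using x V a by (rule quad_form_sum_nonneg)
  also have "\<dots> = (\<Sum>(i, j, k, l) \<in> V \<times> V \<times> V \<times> V. a i * a j * a k * a l *
      (2 * (1 + of_bool (i = j)) * perm_inner S f (pair_op x k l f))
     - a i * a j * a k * a l * perm_inner S (pair_op x i j f) (pair_op x k l f))"
  proof (rule sum.cong[OF refl], clarify)
    fix i j k l assume "i \<in> V" "j \<in> V" "k \<in> V" "l \<in> V"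
    with V have "i \<in> S" "j \<in> S" "k \<in> S" "l \<in> S" by auto
    with x(1) show "a i * a j * a k * a l * perm_inner S f (quad_op x i j k l f) =
      a i * a j * a k * a l * (2 * (1 + of_bool (i = j)) * perm_inner S f (pair_op x k l f))
     - a i * a j * a k * a l * perm_inner S (pair_op x i j f) (pair_op x k l f)"
      by (simp add: perm_inner_quad_op right_diff_distrib)
  qed
  also have "\<dots> = 2 * s * P - perm_inner S h h"
    unfolding sP hh by (simp add: case_prod_unfold sum_subtractf)
  finally have "perm_inner S h h \<le> 2 * s * P" by simp
  moreover have "0 \<le> perm_inner S h h"
    by (simp add: perm_inner_def sum_nonneg)
  ultimately have "0 \<le> s * P" by simp
  with \<open>0 < s\<close> have "0 \<le> P" by (simp add: zero_le_mult_iff)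
  then show ?thesis by (simp add: P_def)
qed

lemma perm_inner_swap_energy:
  assumes "i \<in> S" "j \<in> S"
  shows "2 * perm_inner S f (\<lambda>\<eta>. f (\<eta> \<circ> transpose i j)) = 2 * perm_inner S f f - swap_energy S i j f"
proof -
  have "swap_energy S i j f = (\<Sum>\<eta> | \<eta> permutes S. f (\<eta> \<circ> transpose i j) * f (\<eta> \<circ> transpose i j))
      + perm_inner S f f - 2 * perm_inner S f (\<lambda>\<eta>. f (\<eta> \<circ> transpose i j))"
    unfolding swap_energy_def perm_inner_def
    by (simp add: power2_eq_square algebra_simps sum.distrib sum_subtractf sum_distrib_left)
  also have "(\<Sum>\<eta> | \<eta> permutes S. f (\<eta> \<circ> transpose i j) * f (\<eta> \<circ> transpose i j)) = perm_inner S f f"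
    unfolding perm_inner_def by (rule sum_perm_swap[OF assms, of "\<lambda>\<eta>. f \<eta> * f \<eta>"])
  finally show ?thesis by (simp add: comp_def)
qed

lemma perm_inner_pair_op:
  assumes "x \<in> S" "i \<in> S" "j \<in> S"
  shows "2 * perm_inner S f (pair_op x i j f) =
     swap_energy S x i f + swap_energy S x j f - swap_energy S i j f"
proof -
  have P: "pair_op x i j f = (\<lambda>\<eta>. f \<eta> + f (\<eta> \<circ> transpose i j)
     - f (\<eta> \<circ> transpose x i) - f (\<eta> \<circ> transpose x j))"
    by (simp add: fun_eq_iff pair_op_def)
  show ?thesis
    unfolding P perm_inner_linear
    using perm_inner_swap_energy[OF assms(2,3), of f] perm_inner_swap_energy[OF assms(1,2), of f]
      perm_inner_swap_energy[OF assms(1,3), of f]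
    by argo
qed

text \<open>
  In terms of swap energies \<open>E\<close>, the quadratic form of \<open>p\<^sub>i\<^sub>j\<close> is \<open>(E\<^sub>x\<^sub>i + E\<^sub>x\<^sub>j - E\<^sub>i\<^sub>j) / 2\<close>, so positivity of
  \<open>P\<close> is exactly this inequality.
\<close>

theorem octopus_inequality:
  assumes fin: "finite V" and x: "x \<in> S" "x \<notin> V" and V: "V \<subseteq> S"
    and a: "\<And>i. i \<in> V \<Longrightarrow> 0 \<le> a i"
  shows "(\<Sum>i\<in>V. \<Sum>j\<in>V. a i * a j * swap_energy S i j f)
    \<le> 2 * (\<Sum>i\<in>V. a i) * (\<Sum>i\<in>V. a i * swap_energy S x i f)"
proof -
  let ?E = "\<lambda>i j. swap_energy S i j f"
  have "0 \<le> 2 * (\<Sum>(i, j) \<in> V \<times> V. a i * a j * perm_inner S f (pair_op x i j f))"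
    using pair_form_sum_nonneg[OF assms] by simp
  also have "\<dots> = (\<Sum>i\<in>V. \<Sum>j\<in>V. a i * a j * (2 * perm_inner S f (pair_op x i j f)))"
    by (simp add: sum.cartesian_product[symmetric] sum_distrib_left mult_ac)
  also have "\<dots> = (\<Sum>i\<in>V. \<Sum>j\<in>V. a i * a j * (?E x i + ?E x j - ?E i j))"
    using x V by (intro sum.cong refl) (auto simp: perm_inner_pair_op subset_iff)
  also have "\<dots> = (\<Sum>i\<in>V. \<Sum>j\<in>V. a j * (a i * ?E x i)) + (\<Sum>i\<in>V. \<Sum>j\<in>V. a i * (a j * ?E x j))
      - (\<Sum>i\<in>V. \<Sum>j\<in>V. a i * a j * ?E i j)"
    by (simp add: algebra_simps sum.distrib sum_subtractf)
  also have "(\<Sum>i\<in>V. \<Sum>j\<in>V. a j * (a i * ?E x i)) = (\<Sum>i\<in>V. a i) * (\<Sum>i\<in>V. a i * ?E x i)"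
    by (subst sum.swap) (simp add: sum_product)
  also have "(\<Sum>i\<in>V. \<Sum>j\<in>V. a i * (a j * ?E x j)) = (\<Sum>i\<in>V. a i) * (\<Sum>i\<in>V. a i * ?E x i)"
    by (simp add: sum_product)
  finally show ?thesis by (simp add: algebra_simps)
qed

section \<open>Network reduction\<close>

abbreviation edges :: "nat \<Rightarrow> (nat \<times> nat) set" where
  "edges n \<equiv> {(x, y). x \<in> {1..n} \<and> y \<in> {1..n} \<and> x < y}"

text \<open>
  The sum over edges is the jump rate between two configurations; at most one edge contributes to it.
\<close>

definition exchange_kernel ::
    "nat \<Rightarrow> (nat \<Rightarrow> nat \<Rightarrow> real) \<Rightarrow> (nat \<Rightarrow> nat) \<Rightarrow> (nat \<Rightarrow> nat) \<Rightarrow> real" where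
  "exchange_kernel n c \<eta> \<zeta> = (\<Sum>(x, y) \<in> edges n. c x y * of_bool (\<zeta> = \<eta> \<circ> transpose x y))"

text \<open>
  The star-mesh transformation of electrical networks that eliminates the vertex \<open>Suc n\<close>. If that vertex
  is isolated, division by zero makes the correction vanish, as it should.
\<close>

definition reduced_weights :: "nat \<Rightarrow> (nat \<Rightarrow> nat \<Rightarrow> real) \<Rightarrow> nat \<Rightarrow> nat \<Rightarrow> real" where
  "reduced_weights n c y z = c y z + c (Suc n) y * c (Suc n) z / (\<Sum>w\<in>{1..n}. c (Suc n) w)"

lemma finite_edges: "finite (edges n)"
  by (rule finite_subset[of _ "{1..n} \<times> {1..n}"]) auto

lemma finite_configurations: "finite (configurations n)"
  by (simp add: configurations_def finite_permutations)

lemma weighted_graphD: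
  assumes "weighted_graph n c" "x \<in> {1..n}" "y \<in> {1..n}" "x \<noteq> y"
  shows "c x y = c y x" "0 \<le> c x y"
proof -
  have "c x y = c y x \<and> 0 \<le> c x y"
    using assms(1)[unfolded weighted_graph_def, rule_format, OF assms(2-4)] .
  then show "c x y = c y x" "0 \<le> c x y" by simp_all
qed

lemma weighted_graph_symmetric: "weighted_graph n c \<Longrightarrow> symmetric_on {1..n} c"
  by (auto simp: symmetric_on_def weighted_graph_def)

lemma L_RW_generator:
  assumes "x \<in> {1..n}"
  shows "L_RW n c f x = generator {1..n} c f x"
  unfolding L_RW_def generator_def
  using assms by (subst sum.remove[of "{1..n}" x]) auto

text \<open>
  Sums over ordered pairs are easier to split off a vertex from than sums over pairs \<open>y < z\<close>.
\<close>

lemma sum_edges_symmetric: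
  fixes G :: "nat \<Rightarrow> nat \<Rightarrow> real"
  assumes "\<And>y z. y \<in> {1..n} \<Longrightarrow> z \<in> {1..n} \<Longrightarrow> y \<noteq> z \<Longrightarrow> G y z = G z y" and "\<And>y. G y y = 0"
  shows "(\<Sum>y\<in>{1..n}. \<Sum>z\<in>{1..n}. G y z) = 2 * (\<Sum>(y, z) \<in> edges n. G y z)"
proof -
  let ?L = "{(y, z). y \<in> {1..n} \<and> z \<in> {1..n} \<and> z < y}"
  let ?D = "{(y, z). y \<in> {1..n} \<and> z = y}"
  have fin: "finite ?L" "finite ?D"
    by (rule finite_subset[of _ "{1..n} \<times> {1..n}"]; auto)+
  have "{1..n} \<times> {1..n} = edges n \<union> (?L \<union> ?D)" by auto
  then have "(\<Sum>y\<in>{1..n}. \<Sum>z\<in>{1..n}. G y z) = (\<Sum>(y, z) \<in> edges n \<union> (?L \<union> ?D). G y z)"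
    by (simp only: sum.cartesian_product)
  also have "\<dots> = (\<Sum>(y, z) \<in> edges n. G y z) + (\<Sum>(y, z) \<in> ?L \<union> ?D. G y z)"
    by (rule sum.union_disjoint) (use fin finite_edges in auto)
  also have "(\<Sum>(y, z) \<in> ?L \<union> ?D. G y z) = (\<Sum>(y, z) \<in> ?L. G y z) + (\<Sum>(y, z) \<in> ?D. G y z)"
    by (rule sum.union_disjoint) (use fin in auto)
  also have "(\<Sum>(y, z) \<in> ?D. G y z) = 0"
    using assms(2) by (intro sum.neutral) auto
  also have "(\<Sum>(y, z) \<in> ?L. G y z) = (\<Sum>(y, z) \<in> edges n. G y z)"
    by (rule sum.reindex_bij_witness[where i = prod.swap and j = prod.swap])
      (auto intro!: assms(1))
  finally show ?thesis by simp
qed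

text \<open>
  A tagged particle at \<open>x\<close> moves only under the transpositions that involve \<open>x\<close>, and
  then with the rates of the random walk.
\<close>

lemma L_RW_as_swaps:
  assumes w: "weighted_graph n c" and x: "x \<in> {1..n}"
  shows "(\<Sum>(y, z) \<in> edges n. c y z * (g (transpose y z x) - g x)) = L_RW n c g x"
proof -
  let ?G = "\<lambda>y z. c y z * (g (transpose y z x) - g x)"
  have sym: "c y x = c x y" if "y \<in> {1..n}" "y \<noteq> x" for y
    using that(1) x that(2) by (rule weighted_graphD(1)[OF w])
  have "2 * (\<Sum>(y, z) \<in> edges n. ?G y z) = (\<Sum>y\<in>{1..n}. \<Sum>z\<in>{1..n}. ?G y z)"
    by (rule sum_edges_symmetric[symmetric])
      (auto simp: transpose_commute weighted_graphD(1)[OF w])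
  also have "\<dots> = (\<Sum>y\<in>{1..n}. \<Sum>z\<in>{1..n}.
      (if y = x then c x z * (g z - g x) else 0) + (if z = x then c x y * (g y - g x) else 0))"
    using sym by (intro sum.cong refl) (auto simp: transpose_def)
  also have "\<dots> = (\<Sum>z\<in>{1..n}. c x z * (g z - g x)) + (\<Sum>y\<in>{1..n}. c x y * (g y - g x))"
  proof -
    have "(\<Sum>y\<in>{1..n}. \<Sum>z\<in>{1..n}. if y = x then c x z * (g z - g x) else 0) =
        (\<Sum>z\<in>{1..n}. c x z * (g z - g x))"
      by (subst sum.swap) (use x in simp)
    then show ?thesis using x by (simp add: sum.distrib)
  qed
  also have "\<dots> = 2 * L_RW n c g x"
    using x by (simp add: L_RW_generator generator_def)
  finally show ?thesis by simp
qed

lemma configurations_swap: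
  assumes "(x, y) \<in> edges n"
  shows "\<eta> \<circ> transpose x y \<in> configurations n \<longleftrightarrow> \<eta> \<in> configurations n"
proof -
  have t: "transpose x y permutes {1..n}" using assms by (auto intro!: permutes_swap_id)
  have "\<eta> = (\<eta> \<circ> transpose x y) \<circ> transpose x y" by (simp add: comp_assoc)
  with t show ?thesis unfolding configurations_def by (metis mem_Collect_eq permutes_compose)
qed

lemma sum_exchange_kernel:
  assumes "\<eta> \<in> configurations n"
  shows "(\<Sum>\<zeta>\<in>configurations n. exchange_kernel n c \<eta> \<zeta> * F \<zeta>) =
    (\<Sum>(x, y) \<in> edges n. c x y * F (\<eta> \<circ> transpose x y))"
proof -
  have "(\<Sum>\<zeta>\<in>configurations n. exchange_kernel n c \<eta> \<zeta> * F \<zeta>) =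
    (\<Sum>(x, y) \<in> edges n. \<Sum>\<zeta>\<in>configurations n. c x y * of_bool (\<zeta> = \<eta> \<circ> transpose x y) * F \<zeta>)"
    unfolding exchange_kernel_def sum_distrib_right
    by (subst sum.swap) (simp add: case_prod_unfold)
  also have "\<dots> = (\<Sum>(x, y) \<in> edges n. c x y * F (\<eta> \<circ> transpose x y))"
  proof (rule sum.cong[OF refl], clarify)
    fix x y assume "x \<in> {1..n}" "y \<in> {1..n}" "x < y"
    then have "\<eta> \<circ> transpose x y \<in> configurations n"
      using assms configurations_swap by auto
    then show "(\<Sum>\<zeta>\<in>configurations n. c x y * of_bool (\<zeta> = \<eta> \<circ> transpose x y) * F \<zeta>) =
        c x y * F (\<eta> \<circ> transpose x y)"
      using finite_configurations
      by (subst sum.remove[of _ "\<eta> \<circ> transpose x y"]) (auto intro!: sum.neutral)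
  qed
  finally show ?thesis .
qed

lemma exchange_kernel_symmetric: "symmetric_on (configurations n) (exchange_kernel n c)"
proof -
  have "\<zeta> = \<eta> \<circ> transpose x y \<longleftrightarrow> \<eta> = \<zeta> \<circ> transpose x y" for \<eta> \<zeta> :: "nat \<Rightarrow> nat" and x y
    by (auto simp: comp_assoc)
  then show ?thesis unfolding symmetric_on_def exchange_kernel_def by auto
qed

lemma L_IP_generator:
  assumes "\<eta> \<in> configurations n"
  shows "L_IP n c f \<eta> = generator (configurations n) (exchange_kernel n c) f \<eta>"
  unfolding L_IP_def generator_def
  using sum_exchange_kernel[OF assms, of c "\<lambda>\<zeta>. f \<zeta> - f \<eta>"] by simp

lemma swap_energy_same [simp]: "swap_energy S x x f = 0"
  by (simp add: swap_energy_def)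

lemma swap_energy_commute: "swap_energy S x y f = swap_energy S y x f"
  by (simp add: swap_energy_def transpose_commute)

lemma dirichlet_exchange:
  assumes w: "weighted_graph n c"
  shows "4 * dirichlet (configurations n) (exchange_kernel n c) f f =
    (\<Sum>x\<in>{1..n}. \<Sum>y\<in>{1..n}. c x y * swap_energy {1..n} x y f)"
proof -
  have "2 * dirichlet (configurations n) (exchange_kernel n c) f f =
    (\<Sum>\<eta>\<in>configurations n. \<Sum>(x, y) \<in> edges n. c x y * (f (\<eta> \<circ> transpose x y) - f \<eta>)\<^sup>2)"
    unfolding dirichlet_def using sum_exchange_kernel[of _ n c "\<lambda>\<zeta>. (f \<zeta> - f _) * (f \<zeta> - f _)"]
    by (simp add: power2_eq_square)
  also have "\<dots> = (\<Sum>(x, y) \<in> edges n. c x y * swap_energy {1..n} x y f)"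
    by (subst sum.swap)
      (simp add: case_prod_unfold swap_energy_def configurations_def sum_distrib_left)
  finally have "4 * dirichlet (configurations n) (exchange_kernel n c) f f =
      2 * (\<Sum>(x, y) \<in> edges n. c x y * swap_energy {1..n} x y f)"
    by linarith
  also have "\<dots> = (\<Sum>x\<in>{1..n}. \<Sum>y\<in>{1..n}. c x y * swap_energy {1..n} x y f)"
  proof (rule sum_edges_symmetric[symmetric])
    fix y z assume "y \<in> {1..n}" "z \<in> {1..n}" "y \<noteq> z"
    then have "c y z = c z y" by (rule weighted_graphD(1)[OF w])
    then show "c y z * swap_energy {1..n} y z f = c z y * swap_energy {1..n} z y f"
      by (simp only: swap_energy_commute[of _ y z])
  qed simp
  finally show ?thesis .
qed

lemma weighted_graph_reduced:
  assumes w: "weighted_graph (Suc n) c"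
  shows "weighted_graph n (reduced_weights n c)"
proof -
  note * = weighted_graphD[OF w]
  show ?thesis
    unfolding weighted_graph_def reduced_weights_def
    by (auto intro!: * add_nonneg_nonneg divide_nonneg_nonneg mult_nonneg_nonneg sum_nonneg
        simp: mult.commute)
qed

lemma weight_last:
  assumes "weighted_graph (Suc n) c" "y \<in> {1..n}"
  shows "c y (Suc n) = c (Suc n) y" "0 \<le> c (Suc n) y"
proof -
  have y: "y \<in> {1..Suc n}" "Suc n \<in> {1..Suc n}" "y \<noteq> Suc n" using assms(2) by auto
  show "c y (Suc n) = c (Suc n) y" by (rule weighted_graphD(1)[OF assms(1) y])
  show "0 \<le> c (Suc n) y" by (rule weighted_graphD(2)[OF assms(1) y(2,1) y(3)[symmetric]])
qed

lemma sum_pairs_Suc: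
  fixes G :: "nat \<Rightarrow> nat \<Rightarrow> real"
  assumes "\<And>y. y \<in> {1..n} \<Longrightarrow> G y (Suc n) = G (Suc n) y" "G (Suc n) (Suc n) = 0"
  shows "(\<Sum>y\<in>{1..Suc n}. \<Sum>z\<in>{1..Suc n}. G y z) =
    (\<Sum>y\<in>{1..n}. \<Sum>z\<in>{1..n}. G y z) + 2 * (\<Sum>y\<in>{1..n}. G (Suc n) y)"
proof -
  have "(\<Sum>y\<in>{1..n}. G y (Suc n)) = (\<Sum>y\<in>{1..n}. G (Suc n) y)"
    using assms(1) by (rule sum.cong[OF refl])
  then show ?thesis by (simp add: sum.distrib assms(2))
qed

lemma two_dirichlet:
  "2 * dirichlet S k f g = (\<Sum>x\<in>S. \<Sum>y\<in>S. k x y * ((f y - f x) * (g y - g x)))"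
  by (simp add: dirichlet_def)

text \<open>
  The value \<open>h\<close> is the weighted mean of \<open>g\<close> with weights \<open>a\<close>. Both sides are expressions for twice the total weight times the
  variance of \<open>g\<close>.
\<close>

lemma harmonic_extension_energy:
  fixes a g :: "'a \<Rightarrow> real"
  assumes fin: "finite V" and a: "\<And>w. w \<in> V \<Longrightarrow> 0 \<le> a w"
  defines "C \<equiv> sum a V"
  defines "h \<equiv> (\<Sum>w\<in>V. a w * g w) / C"
  shows "2 * (\<Sum>w\<in>V. a w * ((g w - h) * (g w - h))) =
    (\<Sum>y\<in>V. \<Sum>z\<in>V. a y * a z / C * ((g z - g y) * (g z - g y)))"
proof (cases "C = 0")
  case True
  then have "\<forall>w\<in>V. a w = 0" using fin a by (simp add: C_def sum_nonneg_eq_0_iff)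
  then show ?thesis by simp
next
  case False
  define A where "A = (\<Sum>w\<in>V. a w * g w)"
  define B where "B = (\<Sum>w\<in>V. a w * (g w * g w))"
  have h: "h * C = A" using False by (simp add: h_def A_def)
  have "(\<Sum>w\<in>V. a w * ((g w - h) * (g w - h))) =
      (\<Sum>w\<in>V. a w * (g w * g w) - 2 * h * (a w * g w) + h * h * a w)"
    by (intro sum.cong) (auto simp: algebra_simps)
  also have "\<dots> = B - 2 * h * A + h * h * C"
    by (simp add: sum.distrib sum_subtractf sum_distrib_left A_def B_def C_def)
  finally have L: "(\<Sum>w\<in>V. a w * ((g w - h) * (g w - h))) = B - 2 * h * A + h * h * C" .
  have "(\<Sum>y\<in>V. \<Sum>z\<in>V. a y * a z / C * ((g z - g y) * (g z - g y))) =
      (\<Sum>y\<in>V. \<Sum>z\<in>V. (a y * (a z * (g z * g z)) - 2 * ((a y * g y) * (a z * g z))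
        + (a y * (g y * g y)) * a z) / C)"
    by (intro sum.cong) (auto simp: field_simps)
  also have "\<dots> = (C * B - 2 * (A * A) + B * C) / C"
    by (simp only: sum.distrib sum_subtractf sum_divide_distrib[symmetric]
        sum_distrib_left[symmetric] sum_distrib_right[symmetric] A_def B_def C_def)
  also have "\<dots> = 2 * (B - 2 * h * A + h * h * C)"
    using False by (simp add: h[symmetric] field_simps)
  finally show ?thesis using L by simp
qed

text \<open>
  The harmonic extension of \<open>g\<close> to the removed vertex has the energy of \<open>g\<close> in the reduced
  network. Recentring it does not change the energy, and its square norm is still at least that of
  \<open>g\<close>: since \<open>g\<close> has mean zero, subtracting a constant from \<open>g\<close> only increases the norm.
\<close>

lemma poincare_reduced:
  assumes w: "weighted_graph (Suc n) c" and l: "0 \<le> l" and poin: "poincare {1..Suc n} c l"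
  shows "poincare {1..n} (reduced_weights n c) l"
  unfolding poincare_def
proof (intro allI impI)
  fix g :: "nat \<Rightarrow> real" assume g: "sum g {1..n} = 0"
  let ?a = "c (Suc n)"
  let ?C = "sum ?a {1..n}"
  define h where "h = (\<Sum>w\<in>{1..n}. ?a w * g w) / ?C"
  define mean where "mean = h / real (Suc n)"
  define g' where "g' x = (if x = Suc n then h else g x) - mean" for x
  have g'_low: "g' y = g y - mean" if "y \<in> {1..n}" for y
    using that by (simp add: g'_def)
  have g'_last: "g' (Suc n) = h - mean" by (simp add: g'_def)
  have "sum g' {1..Suc n} = (\<Sum>y\<in>{1..n}. g y - mean) + (h - mean)"
    by (simp add: g'_last g'_low cong: sum.cong_simp)
  also have "\<dots> = h - real (Suc n) * mean"
    using g by (simp add: sum_subtractf algebra_simps)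
  also have "\<dots> = 0" by (simp add: mean_def)
  finally have "l * (\<Sum>x\<in>{1..Suc n}. (g' x)\<^sup>2) \<le> dirichlet {1..Suc n} c g' g'"
    using poin by (simp only: poincare_def)
  moreover have "l * (\<Sum>x\<in>{1..n}. (g x)\<^sup>2) \<le> l * (\<Sum>x\<in>{1..Suc n}. (g' x)\<^sup>2)"
  proof -
    have "(\<Sum>x\<in>{1..n}. (g' x)\<^sup>2) = (\<Sum>x\<in>{1..n}. (g x)\<^sup>2 - 2 * mean * g x + mean\<^sup>2)"
      by (intro sum.cong refl) (simp add: g'_low power2_eq_square algebra_simps)
    also have "\<dots> = (\<Sum>x\<in>{1..n}. (g x)\<^sup>2) + n * mean\<^sup>2"
      using g by (simp add: sum.distrib sum_subtractf sum_distrib_left[symmetric])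
    finally have "(\<Sum>x\<in>{1..n}. (g x)\<^sup>2) \<le> (\<Sum>x\<in>{1..Suc n}. (g' x)\<^sup>2)" by simp
    then show ?thesis using l by (rule mult_left_mono)
  qed
  moreover have "dirichlet {1..Suc n} c g' g' = dirichlet {1..n} (reduced_weights n c) g g"
  proof -
    have "2 * dirichlet {1..Suc n} c g' g' =
        (\<Sum>y\<in>{1..n}. \<Sum>z\<in>{1..n}. c y z * ((g' z - g' y) * (g' z - g' y)))
        + 2 * (\<Sum>y\<in>{1..n}. ?a y * ((g' y - g' (Suc n)) * (g' y - g' (Suc n))))"
    proof -
      have "(\<Sum>y\<in>{1..Suc n}. \<Sum>z\<in>{1..Suc n}. c y z * ((g' z - g' y) * (g' z - g' y))) =
          (\<Sum>y\<in>{1..n}. \<Sum>z\<in>{1..n}. c y z * ((g' z - g' y) * (g' z - g' y)))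
          + 2 * (\<Sum>y\<in>{1..n}. ?a y * ((g' y - g' (Suc n)) * (g' y - g' (Suc n))))"
      proof (rule sum_pairs_Suc)
        fix y assume y: "y \<in> {1..n}"
        have "(g' (Suc n) - g' y) * (g' (Suc n) - g' y) = (g' y - g' (Suc n)) * (g' y - g' (Suc n))"
          by (simp only: minus_diff_eq[of "g' y" "g' (Suc n)", symmetric] minus_mult_minus)
        then show "c y (Suc n) * ((g' (Suc n) - g' y) * (g' (Suc n) - g' y)) =
            ?a y * ((g' y - g' (Suc n)) * (g' y - g' (Suc n)))"
          by (simp only: weight_last(1)[OF w y])
      qed simp
      then show ?thesis by (simp only: two_dirichlet)
    qed
    also have "\<dots> = (\<Sum>y\<in>{1..n}. \<Sum>z\<in>{1..n}. c y z * ((g z - g y) * (g z - g y)))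
        + 2 * (\<Sum>y\<in>{1..n}. ?a y * ((g y - h) * (g y - h)))"
      by (simp add: g'_low g'_last cong: sum.cong_simp)
    also have "2 * (\<Sum>y\<in>{1..n}. ?a y * ((g y - h) * (g y - h))) =
        (\<Sum>y\<in>{1..n}. \<Sum>z\<in>{1..n}. ?a y * ?a z / ?C * ((g z - g y) * (g z - g y)))"
      unfolding h_def by (rule harmonic_extension_energy) (use weight_last[OF w] in auto)
    also have "(\<Sum>y\<in>{1..n}. \<Sum>z\<in>{1..n}. c y z * ((g z - g y) * (g z - g y))) + \<dots> =
        2 * dirichlet {1..n} (reduced_weights n c) g g"
      by (simp only: two_dirichlet reduced_weights_def distrib_right sum.distrib)
    finally show ?thesis by simp
  qed
  ultimately show "l * (\<Sum>x\<in>{1..n}. (g x)\<^sup>2) \<le> dirichlet {1..n} (reduced_weights n c) g g"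
    by linarith
qed

text \<open>
  The configurations of \<open>Suc n\<close> vertices are split according to the particle \<open>b\<close> at the last vertex. Relabelling
  the particles on the left identifies each part with the configurations of \<open>n\<close> vertices and
  commutes with swaps of positions, which act on the right.
\<close>

lemma sum_configurations_Suc:
  "(\<Sum>\<eta>\<in>configurations (Suc n). F \<eta>) =
    (\<Sum>b\<in>{1..Suc n}. \<Sum>\<zeta>\<in>configurations n. F (transpose (Suc n) b \<circ> \<zeta>))"
proof -
  have eq: "{1..Suc n} = insert (Suc n) {1..n}" by auto
  show ?thesis
    unfolding configurations_def eq by (rule sum_over_permutations_insert) auto
qed

lemma swap_energy_fibres:
  "swap_energy {1..Suc n} y z f =
    (\<Sum>b\<in>{1..Suc n}. swap_energy {1..n} y z (\<lambda>\<zeta>. f (transpose (Suc n) b \<circ> \<zeta>)))"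
proof -
  have "swap_energy {1..Suc n} y z f =
      (\<Sum>\<eta>\<in>configurations (Suc n). (f (\<eta> \<circ> transpose y z) - f \<eta>)\<^sup>2)"
    by (simp only: swap_energy_def configurations_def)
  also have "\<dots> = (\<Sum>b\<in>{1..Suc n}. swap_energy {1..n} y z (\<lambda>\<zeta>. f (transpose (Suc n) b \<circ> \<zeta>)))"
    unfolding sum_configurations_Suc by (simp only: swap_energy_def configurations_def comp_assoc)
  finally show ?thesis .
qed

lemma energy_reduced_le:
  assumes w: "weighted_graph (Suc n) c"
  shows "(\<Sum>y\<in>{1..n}. \<Sum>z\<in>{1..n}. reduced_weights n c y z * swap_energy {1..Suc n} y z f)
    \<le> (\<Sum>y\<in>{1..Suc n}. \<Sum>z\<in>{1..Suc n}. c y z * swap_energy {1..Suc n} y z f)"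
proof -
  let ?a = "c (Suc n)" and ?E = "\<lambda>y z. swap_energy {1..Suc n} y z f"
  let ?C = "sum ?a {1..n}"
  have C: "0 \<le> ?C" by (intro sum_nonneg weight_last[OF w])
  have "(\<Sum>y\<in>{1..n}. \<Sum>z\<in>{1..n}. ?a y * ?a z * ?E y z) \<le> 2 * ?C * (\<Sum>y\<in>{1..n}. ?a y * ?E (Suc n) y)"
    by (rule octopus_inequality) (use weight_last[OF w] in auto)
  then have "(\<Sum>y\<in>{1..n}. \<Sum>z\<in>{1..n}. ?a y * ?a z * ?E y z) / ?C
      \<le> 2 * (\<Sum>y\<in>{1..n}. ?a y * ?E (Suc n) y)"
  proof (cases "?C = 0")
    case True
    have "0 \<le> (\<Sum>y\<in>{1..n}. ?a y * ?E (Suc n) y)"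
      by (intro sum_nonneg mult_nonneg_nonneg weight_last[OF w])
        (auto simp: swap_energy_def intro!: sum_nonneg)
    with True show ?thesis by simp
  next
    case False
    with C have "0 < ?C" by simp
    then show ?thesis
      using \<open>_ \<le> 2 * ?C * _\<close> by (simp add: pos_divide_le_eq mult_ac)
  qed
  moreover have "(\<Sum>y\<in>{1..Suc n}. \<Sum>z\<in>{1..Suc n}. c y z * ?E y z) =
      (\<Sum>y\<in>{1..n}. \<Sum>z\<in>{1..n}. c y z * ?E y z) + 2 * (\<Sum>y\<in>{1..n}. ?a y * ?E (Suc n) y)"
    by (rule sum_pairs_Suc) (auto simp: weight_last[OF w] swap_energy_commute)
  ultimately show ?thesis
    by (simp add: reduced_weights_def distrib_right sum.distrib sum_divide_distrib)
qed

section \<open>Comparison of the interchange process with the random walk\<close>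

lemma sum_configurations_swap:
  assumes "(y, z) \<in> edges n"
  shows "(\<Sum>\<eta>\<in>configurations n. h (\<eta> \<circ> transpose y z)) = (\<Sum>\<eta>\<in>configurations n. h \<eta>)"
  unfolding configurations_def using assms by (intro sum_perm_swap) auto

text \<open>
  Summation by parts: a swap of positions is a measure-preserving involution of the configurations.
\<close>

lemma sum_L_IP:
  "(\<Sum>\<eta>\<in>configurations n. G \<eta> * L_IP n c f \<eta>) =
    (\<Sum>(y, z) \<in> edges n. c y z * (\<Sum>\<eta>\<in>configurations n. (G (\<eta> \<circ> transpose y z) - G \<eta>) * f \<eta>))"
proof -
  have "(\<Sum>\<eta>\<in>configurations n. G \<eta> * L_IP n c f \<eta>) =
      (\<Sum>(y, z) \<in> edges n. c y z * (\<Sum>\<eta>\<in>configurations n. G \<eta> * (f (\<eta> \<circ> transpose y z) - f \<eta>)))"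
    unfolding L_IP_def sum_distrib_left
    by (subst sum.swap) (simp add: case_prod_unfold mult.left_commute)
  also have "\<dots> = (\<Sum>(y, z) \<in> edges n.
      c y z * (\<Sum>\<eta>\<in>configurations n. (G (\<eta> \<circ> transpose y z) - G \<eta>) * f \<eta>))"
  proof (rule sum.cong[OF refl], clarify)
    fix y z assume yz: "y \<in> {1..n}" "z \<in> {1..n}" "y < z"
    have "(\<Sum>\<eta>\<in>configurations n. G \<eta> * f (\<eta> \<circ> transpose y z)) =
        (\<Sum>\<eta>\<in>configurations n. G (\<eta> \<circ> transpose y z) * f \<eta>)"
      using sum_configurations_swap[of y z n "\<lambda>\<eta>. G (\<eta> \<circ> transpose y z) * f \<eta>"] yz
      by (simp add: comp_assoc)
    then show "c y z * (\<Sum>\<eta>\<in>configurations n. G \<eta> * (f (\<eta> \<circ> transpose y z) - f \<eta>)) =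
        c y z * (\<Sum>\<eta>\<in>configurations n. (G (\<eta> \<circ> transpose y z) - G \<eta>) * f \<eta>)"
      by (simp only: right_diff_distrib left_diff_distrib sum_subtractf)
  qed
  finally show ?thesis .
qed

definition one_particle_marginal :: "nat \<Rightarrow> nat \<Rightarrow> ((nat \<Rightarrow> nat) \<Rightarrow> real) \<Rightarrow> nat \<Rightarrow> real" where
  "one_particle_marginal n i f x = (\<Sum>\<eta>\<in>configurations n. of_bool (\<eta> x = i) * f \<eta>)"

text \<open>
  The position of particle \<open>i\<close> is itself a Markov process, namely the random walk, so that conditioning on this
  position intertwines the two generators.
\<close>

lemma L_RW_marginal:
  assumes w: "weighted_graph n c" and x: "x \<in> {1..n}"
  shows "L_RW n c (one_particle_marginal n i f) x = one_particle_marginal n i (L_IP n c f) x"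
proof -
  have "one_particle_marginal n i (L_IP n c f) x = (\<Sum>(y, z) \<in> edges n.
      c y z * (one_particle_marginal n i f (transpose y z x) - one_particle_marginal n i f x))"
    unfolding one_particle_marginal_def sum_L_IP
    by (simp add: left_diff_distrib sum_subtractf)
  then show ?thesis using L_RW_as_swaps[OF w x] by simp
qed

text \<open>
  The adjoint of the previous statement. The lifted function is \<open>g\<close> evaluated at the position of
  particle \<open>i\<close>.
\<close>

lemma L_IP_lift:
  assumes w: "weighted_graph n c"
  shows "L_IP n c (\<lambda>\<eta>. \<Sum>x\<in>{1..n}. of_bool (\<eta> x = i) * g x) \<eta> =
    (\<Sum>x\<in>{1..n}. of_bool (\<eta> x = i) * L_RW n c g x)"
proof -
  have swap: "(\<Sum>x\<in>{1..n}. of_bool ((\<eta> \<circ> transpose y z) x = i) * g x) =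
      (\<Sum>x\<in>{1..n}. of_bool (\<eta> x = i) * g (transpose y z x))" if "y \<in> {1..n}" "z \<in> {1..n}" for y z
    by (rule sum.reindex_bij_witness[where i = "transpose y z" and j = "transpose y z"])
      (use that in \<open>auto simp: transpose_def\<close>)
  have "L_IP n c (\<lambda>\<eta>. \<Sum>x\<in>{1..n}. of_bool (\<eta> x = i) * g x) \<eta> =
      (\<Sum>(y, z) \<in> edges n. \<Sum>x\<in>{1..n}. of_bool (\<eta> x = i) * (c y z * (g (transpose y z x) - g x)))"
    unfolding L_IP_def
  proof (rule sum.cong[OF refl], clarify)
    fix y z assume "y \<in> {1..n}" "z \<in> {1..n}"
    then show "c y z * ((\<Sum>x\<in>{1..n}. of_bool ((\<eta> \<circ> transpose y z) x = i) * g x)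
        - (\<Sum>x\<in>{1..n}. of_bool (\<eta> x = i) * g x)) =
        (\<Sum>x\<in>{1..n}. of_bool (\<eta> x = i) * (c y z * (g (transpose y z x) - g x)))"
      by (simp only: swap sum_subtractf[symmetric] sum_distrib_left) (simp add: algebra_simps)
  qed
  also have "\<dots> = (\<Sum>x\<in>{1..n}. of_bool (\<eta> x = i) *
      (\<Sum>(y, z) \<in> edges n. c y z * (g (transpose y z x) - g x)))"
    unfolding sum_distrib_left by (subst sum.swap) (simp add: case_prod_unfold)
  also have "\<dots> = (\<Sum>x\<in>{1..n}. of_bool (\<eta> x = i) * L_RW n c g x)"
    by (intro sum.cong refl) (simp only: L_RW_as_swaps[OF w])
  finally show ?thesis .
qed

lemma sum_marginal:
  assumes "i \<in> {1..n}"
  shows "(\<Sum>x\<in>{1..n}. one_particle_marginal n i f x) = (\<Sum>\<eta>\<in>configurations n. f \<eta>)"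
proof -
  have "(\<Sum>x\<in>{1..n}. of_bool (\<eta> x = i) * f \<eta>) = f \<eta>" if "\<eta> \<in> configurations n" for \<eta>
  proof -
    have p: "\<eta> permutes {1..n}" using that by (simp add: configurations_def)
    then have "inv \<eta> i \<in> {1..n}" using assms permutes_in_image[OF permutes_inv[OF p]] by simp
    moreover have "of_bool (\<eta> x = i) * f \<eta> = (if x = inv \<eta> i then f \<eta> else 0)" for x
      using permutes_inverses[OF p] by auto
    ultimately show ?thesis by simp
  qed
  then show ?thesis
    unfolding one_particle_marginal_def by (subst sum.swap) (rule sum.cong[OF refl])
qed

lemma marginal_last:
  assumes "i \<in> {1..Suc n}"
  shows "one_particle_marginal (Suc n) i f (Suc n) =
    (\<Sum>\<zeta>\<in>configurations n. f (transpose (Suc n) i \<circ> \<zeta>))"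
proof -
  have last: "(transpose (Suc n) b \<circ> \<zeta>) (Suc n) = b" if "\<zeta> \<in> configurations n" for b \<zeta>
  proof -
    have "\<zeta> (Suc n) = Suc n"
      using that by (auto simp: configurations_def permutes_def)
    then show ?thesis by simp
  qed
  have "one_particle_marginal (Suc n) i f (Suc n) =
      (\<Sum>b\<in>{1..Suc n}. \<Sum>\<zeta>\<in>configurations n. of_bool (b = i) * f (transpose (Suc n) b \<circ> \<zeta>))"
    unfolding one_particle_marginal_def sum_configurations_Suc
    by (intro sum.cong refl) (simp only: last)
  also have "\<dots> = (\<Sum>b\<in>{1..Suc n}. if b = i then \<Sum>\<zeta>\<in>configurations n. f (transpose (Suc n) b \<circ> \<zeta>) else 0)"
    by (intro sum.cong refl) simp
  also have "\<dots> = (\<Sum>\<zeta>\<in>configurations n. f (transpose (Suc n) i \<circ> \<zeta>))"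
    using assms by (simp only: sum.delta finite_atLeastAtMost if_True)
  finally show ?thesis .
qed

text \<open>
  On each part with a fixed particle at the last vertex, \<open>f\<close> has mean zero and obeys the Poincare
  inequality of the reduced network. Adding these up gives the energy of \<open>f\<close> for the reduced weights, which
  the octopus inequality bounds by the full energy.
\<close>

lemma poincare_on_centred_fibres:
  assumes w: "weighted_graph (Suc n) c"
    and poin: "poincare (configurations n) (exchange_kernel n (reduced_weights n c)) l"
    and zero: "\<And>i. i \<in> {1..Suc n} \<Longrightarrow> one_particle_marginal (Suc n) i f (Suc n) = 0"
  shows "l * (\<Sum>\<eta>\<in>configurations (Suc n). (f \<eta>)\<^sup>2) \<le>
    dirichlet (configurations (Suc n)) (exchange_kernel (Suc n) c) f f"
proof -
  let ?f = "\<lambda>b \<zeta>. f (transpose (Suc n) b \<circ> \<zeta>)"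
  let ?c = "reduced_weights n c"
  have "4 * (l * (\<Sum>\<eta>\<in>configurations (Suc n). (f \<eta>)\<^sup>2)) =
      (\<Sum>b\<in>{1..Suc n}. 4 * (l * (\<Sum>\<zeta>\<in>configurations n. (?f b \<zeta>)\<^sup>2)))"
    by (simp only: sum_configurations_Suc sum_distrib_left)
  also have "\<dots> \<le> (\<Sum>b\<in>{1..Suc n}. 4 * dirichlet (configurations n) (exchange_kernel n ?c) (?f b) (?f b))"
  proof (rule sum_mono)
    fix b assume "b \<in> {1..Suc n}"
    then have "(\<Sum>\<zeta>\<in>configurations n. ?f b \<zeta>) = 0"
      using zero marginal_last by metis
    then show "4 * (l * (\<Sum>\<zeta>\<in>configurations n. (?f b \<zeta>)\<^sup>2)) \<le>
        4 * dirichlet (configurations n) (exchange_kernel n ?c) (?f b) (?f b)"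
      using poin unfolding poincare_def by (intro mult_left_mono) auto
  qed
  also have "\<dots> = (\<Sum>b\<in>{1..Suc n}. \<Sum>y\<in>{1..n}. \<Sum>z\<in>{1..n}. ?c y z * swap_energy {1..n} y z (?f b))"
    by (simp only: dirichlet_exchange[OF weighted_graph_reduced[OF w]])
  also have "\<dots> = (\<Sum>y\<in>{1..n}. \<Sum>z\<in>{1..n}. ?c y z * swap_energy {1..Suc n} y z f)"
    by (simp only: swap_energy_fibres sum_distrib_left sum.swap[of _ _ "{1..Suc n}"])
  also have "\<dots> \<le> (\<Sum>y\<in>{1..Suc n}. \<Sum>z\<in>{1..Suc n}. c y z * swap_energy {1..Suc n} y z f)"
    by (rule energy_reduced_le[OF w])
  also have "\<dots> = 4 * dirichlet (configurations (Suc n)) (exchange_kernel (Suc n) c) f f"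
    by (rule dirichlet_exchange[OF w, symmetric])
  finally show ?thesis by simp
qed

lemma rayleigh_eigenfunction:
  assumes "symmetric_on S k" "\<And>x. x \<in> S \<Longrightarrow> generator S k f x = - m * f x"
  shows "dirichlet S k f f = m * (\<Sum>x\<in>S. (f x)\<^sup>2)"
  unfolding dirichlet_green[OF assms(1)] using assms(2)
  by (simp add: sum_distrib_left sum_negf power2_eq_square mult_ac)

lemma le_eigenvalue:
  assumes fin: "finite S" and sym: "symmetric_on S k"
    and eig: "\<And>x. x \<in> S \<Longrightarrow> generator S k f x = - m * f x" and nz: "\<exists>x\<in>S. f x \<noteq> 0"
    and le: "l * (\<Sum>x\<in>S. (f x)\<^sup>2) \<le> dirichlet S k f f"
  shows "l \<le> m"
proof -
  obtain x where "x \<in> S" "f x \<noteq> 0" using nz by blast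
  then have "0 < (\<Sum>x\<in>S. (f x)\<^sup>2)" using fin by (intro sum_pos2[of S x]) auto
  with le show ?thesis by (simp add: rayleigh_eigenfunction[OF sym eig])
qed

text \<open>
  It suffices to compare \<open>l\<close> with the optimal constant \<open>m\<close> of the interchange process, which is attained
  by an eigenfunction \<open>f\<close>. Either a one-particle marginal of \<open>f\<close> is a nonzero eigenfunction of the walk, or
  \<open>f\<close> is centred given the particle at the last vertex and the induction hypothesis applies to the
  reduced network.
\<close>

theorem poincare_exchange:
  assumes "weighted_graph n c" "0 \<le> l" "poincare {1..n} c l"
  shows "poincare (configurations n) (exchange_kernel n c) l"
  using assms
proof (induction n arbitrary: c)
  case 0
  have "configurations 0 = {id}" by (auto simp: configurations_def)
  then show ?case by (simp add: poincare_def dirichlet_def)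
next
  case (Suc n)
  let ?X = "configurations (Suc n)" and ?k = "exchange_kernel (Suc n) c"
  note w = Suc.prems(1) and l = Suc.prems(2) and rw = Suc.prems(3)
  have card: "card ?X = fact (Suc n)"
    unfolding configurations_def by (rule card_permutations) auto
  show ?case
  \<comment> \<open>a single vertex has one configuration only, and no nonzero function on it has mean zero\<close>
  proof (cases "n = 0")
    case True
    with card have "card ?X = 1" by simp
    then obtain \<eta> where "?X = {\<eta>}" by (auto simp: card_1_singleton_iff)
    then show ?thesis by (simp add: poincare_def dirichlet_def)
  next
    case False
    have "fact 2 \<le> (fact (Suc n) :: nat)" by (rule fact_mono) (use False in simp)
    with card have "2 \<le> card ?X" by (simp add: fact_numeral)
    then obtain m f where poin: "poincare ?X ?k m" and nz: "\<exists>\<eta>\<in>?X. f \<eta> \<noteq> 0" and f0: "sum f ?X = 0"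
      and gen: "\<And>\<eta>. \<eta> \<in> ?X \<Longrightarrow> generator ?X ?k f \<eta> = - m * f \<eta>"
      using ex_poincare_eigenfunction[OF finite_configurations _ exchange_kernel_symmetric] by metis
    have IP: "L_IP (Suc n) c f \<eta> = - m * f \<eta>" if "\<eta> \<in> ?X" for \<eta>
      using that gen L_IP_generator by metis
    have "l \<le> m"
    proof (cases "\<exists>i\<in>{1..Suc n}. one_particle_marginal (Suc n) i f (Suc n) \<noteq> 0")
      case True
      then obtain i where i: "i \<in> {1..Suc n}" "one_particle_marginal (Suc n) i f (Suc n) \<noteq> 0"
        by blast
      let ?g = "one_particle_marginal (Suc n) i f"
      show ?thesis
      proof (rule le_eigenvalue[of "{1..Suc n}" c ?g])
        show "symmetric_on {1..Suc n} c" using w by (rule weighted_graph_symmetric)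
        show "\<exists>x\<in>{1..Suc n}. ?g x \<noteq> 0" using i by auto
        have "sum ?g {1..Suc n} = 0" using sum_marginal[OF i(1)] f0 by simp
        then show "l * (\<Sum>x\<in>{1..Suc n}. (?g x)\<^sup>2) \<le> dirichlet {1..Suc n} c ?g ?g"
          using rw by (simp only: poincare_def)
        fix x assume x: "x \<in> {1..Suc n}"
        have "one_particle_marginal (Suc n) i (L_IP (Suc n) c f) x = - m * ?g x"
          unfolding one_particle_marginal_def sum_distrib_left
          by (intro sum.cong refl) (simp add: IP)
        then show "generator {1..Suc n} c ?g x = - m * ?g x"
          using L_RW_marginal[OF w x] L_RW_generator[OF x] by metis
      qed simp
    next
      case False
      have "poincare (configurations n) (exchange_kernel n (reduced_weights n c)) l"
        using Suc.IH weighted_graph_reduced[OF w] l poincare_reduced[OF w l rw] by blast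
      then have "l * (\<Sum>\<eta>\<in>?X. (f \<eta>)\<^sup>2) \<le> dirichlet ?X ?k f f"
        using poincare_on_centred_fibres[OF w] False by blast
      then show ?thesis
        using le_eigenvalue[OF finite_configurations exchange_kernel_symmetric gen nz] by blast
    qed
    show ?thesis
      unfolding poincare_def
    proof (intro allI impI)
      fix h :: "(nat \<Rightarrow> nat) \<Rightarrow> real" assume "sum h ?X = 0"
      then have "m * (\<Sum>\<eta>\<in>?X. (h \<eta>)\<^sup>2) \<le> dirichlet ?X ?k h h"
        using poin by (simp only: poincare_def)
      moreover have "l * (\<Sum>\<eta>\<in>?X. (h \<eta>)\<^sup>2) \<le> m * (\<Sum>\<eta>\<in>?X. (h \<eta>)\<^sup>2)"
        using \<open>l \<le> m\<close> by (intro mult_right_mono sum_nonneg) auto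
      ultimately show "l * (\<Sum>\<eta>\<in>?X. (h \<eta>)\<^sup>2) \<le> dirichlet ?X ?k h h" by linarith
    qed
  qed
qed

text \<open>
  A function of energy zero is constant along every edge of positive weight.
\<close>

lemma connected_eigenvalue_pos:
  assumes w: "weighted_graph n c" and conn: "skeleton_connected n c"
    and nz: "\<exists>x\<in>{1..n}. f x \<noteq> 0" and f0: "sum f {1..n} = 0"
    and eig: "\<And>x. x \<in> {1..n} \<Longrightarrow> generator {1..n} c f x = - m * f x"
  shows "0 < m"
proof (rule ccontr)
  assume "\<not> 0 < m"
  have summand_nonneg: "0 \<le> c x y * ((f y - f x) * (f y - f x))" if "x \<in> {1..n}" "y \<in> {1..n}" for x y
    using w that unfolding weighted_graph_def by (cases "x = y") auto
  have "dirichlet {1..n} c f f \<le> 0"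
    using \<open>\<not> 0 < m\<close> rayleigh_eigenfunction[OF weighted_graph_symmetric[OF w] eig]
    by (simp add: mult_nonpos_nonneg sum_nonneg)
  then have "(\<Sum>x\<in>{1..n}. \<Sum>y\<in>{1..n}. c x y * ((f y - f x) * (f y - f x))) \<le> 0"
    by (simp add: dirichlet_def)
  then have "(\<Sum>x\<in>{1..n}. \<Sum>y\<in>{1..n}. c x y * ((f y - f x) * (f y - f x))) = 0"
    using summand_nonneg by (intro order_antisym sum_nonneg) auto
  then have "\<forall>x\<in>{1..n}. (\<Sum>y\<in>{1..n}. c x y * ((f y - f x) * (f y - f x))) = 0"
    by (subst (asm) sum_nonneg_eq_0_iff) (auto intro!: sum_nonneg summand_nonneg)
  then have zero: "c x y * ((f y - f x) * (f y - f x)) = 0" if "x \<in> {1..n}" "y \<in> {1..n}" for x y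
    using that summand_nonneg sum_nonneg_eq_0_iff[of "{1..n}" "\<lambda>y. c x y * ((f y - f x) * (f y - f x))"]
    by blast
  have edge: "f y = f x" if "(x, y) \<in> skeleton n c" for x y
    using zero[of x y] that by (auto simp: skeleton_def)
  have path: "f y = f x" if "(x, y) \<in> (skeleton n c)\<^sup>*" for x y
    using that by (induction rule: rtrancl_induct) (auto dest: edge)
  obtain x where x: "x \<in> {1..n}" "f x \<noteq> 0" using nz by blast
  then have "f y = f x" if "y \<in> {1..n}" for y
    using conn that path unfolding skeleton_connected_def by blast
  then have "sum f {1..n} = real n * f x" by simp
  with f0 x show False by simp
qed

theorem theorem1p1:
  fixes n :: nat and c :: "nat \<Rightarrow> nat \<Rightarrow> real"
  assumes "n \<ge> 2"
    and "weighted_graph n c"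
    and "skeleton_connected n c"
  shows "gap_IP n c = gap_RW n c"
proof -
  note w = assms(2)
  obtain m g where poin: "poincare {1..n} c m" and nz: "\<exists>x\<in>{1..n}. g x \<noteq> 0" and g0: "sum g {1..n} = 0"
    and eig: "\<And>x. x \<in> {1..n} \<Longrightarrow> generator {1..n} c g x = - m * g x"
    using ex_poincare_eigenfunction[OF _ _ weighted_graph_symmetric[OF w]] assms(1)
    by (metis card_atLeastAtMost diff_Suc_1 finite_atLeastAtMost)
  have m: "0 < m"
    using w assms(3) nz g0 eig by (rule connected_eigenvalue_pos)
  have "gap_RW n c = m"
    unfolding gap_RW_def
    using spectral_gap_eqI[OF _ weighted_graph_symmetric[OF w] L_RW_generator m poin nz eig] by simp
  moreover have "gap_IP n c = m"
  proof -
    \<comment> \<open>\<open>g\<close> evaluated at the position of particle \<open>1\<close>\<close>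
    let ?f = "\<lambda>\<eta>. \<Sum>x\<in>{1..n}. of_bool (\<eta> x = 1) * g x"
    have eigf: "generator (configurations n) (exchange_kernel n c) ?f \<eta> = - m * ?f \<eta>"
      if "\<eta> \<in> configurations n" for \<eta>
    proof -
      have "generator (configurations n) (exchange_kernel n c) ?f \<eta> = L_IP n c ?f \<eta>"
        using that by (rule L_IP_generator[symmetric])
      also have "\<dots> = (\<Sum>x\<in>{1..n}. of_bool (\<eta> x = 1) * L_RW n c g x)"
        by (rule L_IP_lift[OF w])
      also have "\<dots> = (\<Sum>x\<in>{1..n}. - m * (of_bool (\<eta> x = 1) * g x))"
      proof (rule sum.cong[OF refl])
        fix x assume "x \<in> {1..n}"
        then have "L_RW n c g x = - m * g x" by (simp only: L_RW_generator eig)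
        then show "of_bool (\<eta> x = 1) * L_RW n c g x = - m * (of_bool (\<eta> x = 1) * g x)" by simp
      qed
      finally show ?thesis by (simp only: sum_distrib_left)
    qed
    have nzf: "\<exists>\<eta>\<in>configurations n. ?f \<eta> \<noteq> 0"
    proof -
      obtain x where x: "x \<in> {1..n}" "g x \<noteq> 0" using nz by blast
      show ?thesis
      proof
        show "transpose 1 x \<in> configurations n"
          using x(1) assms(1) by (auto simp: configurations_def intro!: permutes_swap_id)
        have "of_bool (transpose 1 x y = 1) * g y = (if y = x then g x else 0)" for y
          by (auto simp: transpose_def)
        then have "?f (transpose 1 x) = g x" using x(1) by simp
        then show "?f (transpose 1 x) \<noteq> 0" using x(2) by simp
      qed
    qed
    show ?thesis
      unfolding gap_IP_def
    proof (rule spectral_gap_eqI[OF finite_configurations exchange_kernel_symmetric])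
      show "L_IP n c f \<eta> = generator (configurations n) (exchange_kernel n c) f \<eta>"
        if "\<eta> \<in> configurations n" for f \<eta>
        using that by (rule L_IP_generator)
      show "0 < m" by (rule m)
      show "\<exists>\<eta>\<in>configurations n. ?f \<eta> \<noteq> 0" by (rule nzf)
      show "poincare (configurations n) (exchange_kernel n c) m"
        by (rule poincare_exchange[OF w less_imp_le[OF m] poin])
      show "generator (configurations n) (exchange_kernel n c) ?f \<eta> = - m * ?f \<eta>"
        if "\<eta> \<in> configurations n" for \<eta>
        using that by (rule eigf)
    qed
  qed
  ultimately show ?thesis by simp
qed

end
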